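(* Let $G=(V,E,w)$ be a finite vertex-weighted graph with nonnegative rational vertex weights and maximum degree $\Delta$. For any $\varepsilon\in(0,0.1]$ and integer $k\in\mathbb{Z}_+$, if $k\ge\frac{\Delta+1}{\varepsilon}$ and $\max_{v\in V}w_v\le\varepsilon\frac{w(V)}{k}$, then $G$ admits a $(1+7\varepsilon)$-EQ1 $k$-coloring, and such a coloring can be computed in polynomial time.
   Context: For $S\subseteq V$, $w(S)=\sum_{v\in S}w_v$. A $k$-coloring of $G$ is a partition $(C_1,\dots,C_k)$ of $V$ into $k$ (possibly empty) sets, each of which is an independent set of $G$. For $\alpha\ge 1$, a coloring $(C_1,\dots,C_k)$ is $\alpha$-EQ1 if for every $i,j\in[k]$ with $C_i\neq\emptyset$ there exists a vertex $\bar v\in C_i$ such that $w(C_i\setminus\{\bar v\})\le \alpha\, w(C_j)$. *)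

theory Defs
  imports
    Complex_Main
    "HOL-Library.Disjoint_Sets"
    "HOL-Library.Discrete_Functions"
    "HOL-Computational_Algebra.Polynomial"
begin

definition weighted_graph :: "'a set \<Rightarrow> 'a set set \<Rightarrow> ('a \<Rightarrow> rat) \<Rightarrow> bool" where
  "weighted_graph V E w \<longleftrightarrow>
     finite V \<and> (\<forall>e\<in>E. e \<subseteq> V \<and> card e = 2) \<and> (\<forall>v\<in>V. 0 \<le> w v)"

definition vertex_degree :: "'a set set \<Rightarrow> 'a \<Rightarrow> nat" where
  "vertex_degree E v = card {e \<in> E. v \<in> e}"

text \<open>Inserting 0 only matters for the empty graph, where both maxima are taken to be 0.\<close>

definition max_degree :: "'a set \<Rightarrow> 'a set set \<Rightarrow> nat" where
  "max_degree V E = Max (insert 0 (vertex_degree E ` V))"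

definition max_weight :: "'a set \<Rightarrow> ('a \<Rightarrow> rat) \<Rightarrow> rat" where
  "max_weight V w = Max (insert 0 (w ` V))"

definition independent_set :: "'a set set \<Rightarrow> 'a set \<Rightarrow> bool" where
  "independent_set E S \<longleftrightarrow> (\<forall>u\<in>S. \<forall>v\<in>S. {u, v} \<notin> E)"

definition k_coloring :: "'a set \<Rightarrow> 'a set set \<Rightarrow> nat \<Rightarrow> (nat \<Rightarrow> 'a set) \<Rightarrow> bool" where
  "k_coloring V E k C \<longleftrightarrow>
     (\<Union>i\<in>{1..k}. C i) = V \<and> disjoint_family_on C {1..k} \<and>
     (\<forall>i\<in>{1..k}. independent_set E (C i))"

definition EQ1 :: "real \<Rightarrow> ('a \<Rightarrow> rat) \<Rightarrow> nat \<Rightarrow> (nat \<Rightarrow> 'a set) \<Rightarrow> bool" where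
  "EQ1 \<alpha> w k C \<longleftrightarrow>
     (\<forall>i\<in>{1..k}. \<forall>j\<in>{1..k}. C i \<noteq> {} \<longrightarrow>
        (\<exists>v\<in>C i. real_of_rat (sum w (C i - {v})) \<le> \<alpha> * real_of_rat (sum w (C j))))"

text \<open>
  Structured programs over binary trees with natural numbers at the leaves, in the style of
  Jones's WHILE language, with the logarithmic cost criterion for the numbers.  A program
  transforms one tree.  Every elementary operation is charged the bit size of the whole tree it
  is applied to plus that of its result, so that the running time also bounds the size of all
  intermediate data; up to polynomials, running time agrees with that of Turing machines.
\<close>

datatype val = Num nat | Node val val

text \<open>For positive \<open>n\<close>, \<open>floor_log n + 1\<close> is the length of the binary representation of \<open>n\<close>.\<close>

primrec val_size :: "val \<Rightarrow> nat" where
  "val_size (Num n) = floor_log n + 1"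
| "val_size (Node a b) = val_size a + val_size b + 1"

datatype operation = Const nat | Ident | First | Second | Add | Sub | Mult

text \<open>Subtraction is truncated, and ill-typed applications yield 0.\<close>

fun apply_op :: "operation \<Rightarrow> val \<Rightarrow> val" where
  "apply_op (Const n) x = Num n"
| "apply_op Ident x = x"
| "apply_op First (Node a b) = a"
| "apply_op Second (Node a b) = b"
| "apply_op Add (Node (Num m) (Num n)) = Num (m + n)"
| "apply_op Sub (Node (Num m) (Num n)) = Num (m - n)"
| "apply_op Mult (Node (Num m) (Num n)) = Num (m * n)"
| "apply_op _ _ = Num 0"

datatype prog =
    Op operation
  | Seq prog prog
  | Fork prog prog
  | Cond prog prog prog
  | While prog prog

text \<open>
  \<open>run p x y t\<close>: on input \<open>x\<close>, program \<open>p\<close> halts with output \<open>y\<close> after time \<open>t\<close>.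
  In tests, \<open>Num 0\<close> stands for false and every other value for true.
\<close>

inductive run :: "prog \<Rightarrow> val \<Rightarrow> val \<Rightarrow> nat \<Rightarrow> bool" where
  run_Op: "run (Op f) x (apply_op f x) (val_size x + val_size (apply_op f x))"
| run_Seq: "run p x y s \<Longrightarrow> run q y z t \<Longrightarrow> run (Seq p q) x z (s + t)"
| run_Fork: "run p x y s \<Longrightarrow> run q x z t \<Longrightarrow> run (Fork p q) x (Node y z) (s + t + 1)"
| run_Cond_true: "run b x d s \<Longrightarrow> d \<noteq> Num 0 \<Longrightarrow> run p x y t \<Longrightarrow> run (Cond b p q) x y (s + t)"
| run_Cond_false: "run b x (Num 0) s \<Longrightarrow> run q x y t \<Longrightarrow> run (Cond b p q) x y (s + t)"
| run_While_true: "run b x d s \<Longrightarrow> d \<noteq> Num 0 \<Longrightarrow> run p x y t \<Longrightarrow> run (While b p) y z r \<Longrightarrow>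
    run (While b p) x z (s + t + r)"
| run_While_false: "run b x (Num 0) s \<Longrightarrow> run (While b p) x x s"

lemma run_deterministic:
  "run p x y t \<Longrightarrow> run p x y' t' \<Longrightarrow> y = y' \<and> t = t'"
proof (induction arbitrary: y' t' rule: run.induct)
  case (run_Op f x)
  then show ?case by (auto elim: run.cases)
next
  case (run_Seq p x y s q z t)
  from run_Seq.prems show ?case by cases (use run_Seq.IH in blast)
next
  case (run_Fork p x y s q z t)
  from run_Fork.prems show ?case by cases (use run_Fork.IH in blast)
next
  case (run_Cond_true b x d s p y t q)
  from run_Cond_true.prems show ?case by cases (use run_Cond_true in blast)+
next
  case (run_Cond_false b x s q y t p)
  from run_Cond_false.prems show ?case by cases (use run_Cond_false in blast)+
next
  case (run_While_true b x d s p y t z r)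
  from run_While_true.prems show ?case by cases (use run_While_true in blast)+
next
  case (run_While_false b x s p)
  from run_While_false.prems show ?case by cases (use run_While_false in blast)+
qed

lemma run_time_ge_size:
  "run p x y t \<Longrightarrow> val_size x \<le> t \<and> val_size y \<le> t"
  by (induction rule: run.induct) auto

fun enc_list :: "val list \<Rightarrow> val" where
  "enc_list [] = Num 0"
| "enc_list (x # xs) = Node x (enc_list xs)"

text \<open>Nonnegative rationals: numerator and denominator in lowest terms, in binary.\<close>

definition enc_rat :: "rat \<Rightarrow> val" where
  "enc_rat r = Node (Num (nat (fst (quotient_of r)))) (Num (nat (snd (quotient_of r))))"

text \<open>
  A graph with vertex set \<open>{..<n}\<close> together with the number \<open>k\<close> (in binary): for each vertex its
  weight and its row of the adjacency matrix.
\<close>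

definition enc_instance :: "nat \<Rightarrow> nat set set \<Rightarrow> (nat \<Rightarrow> rat) \<Rightarrow> nat \<Rightarrow> val" where
  "enc_instance n E w k =
     Node (Num k)
       (enc_list (map (\<lambda>u. Node (enc_rat (w u))
          (enc_list (map (\<lambda>v. Num (if {u, v} \<in> E then 1 else 0)) [0..<n]))) [0..<n]))"

text \<open>A coloring is output as the list of the colors \<open>c 0, \<dots>, c (n - 1)\<close> of the vertices.\<close>

definition enc_colors :: "nat \<Rightarrow> (nat \<Rightarrow> nat) \<Rightarrow> val" where
  "enc_colors n c = enc_list (map (\<lambda>v. Num (c v)) [0..<n])"

definition color_class :: "nat \<Rightarrow> (nat \<Rightarrow> nat) \<Rightarrow> nat \<Rightarrow> nat set" where
  "color_class n c i = {v. v < n \<and> c v = i}"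

end

theory Submission
  imports Defs
begin

text \<open>
  Colour the vertices in order of decreasing weight, giving each one a least loaded colour among
  those not used by its neighbours.  Let \<open>W = w(V)/k\<close>.

  At most \<open>\<Delta> \<le> \<epsilon> k\<close> colours are forbidden for a vertex, so the class it joins has weight at most that of
  \<open>(1 - \<epsilon>) k\<close> classes; hence a class without its last vertex weighs at most \<open>W / (1 - \<epsilon>)\<close>.

  Conversely, let class \<open>j\<close> have final weight \<open>m\<close>.  A vertex that joins a class heavier than \<open>m\<close> has a
  neighbour in class \<open>j\<close> that was coloured before and hence is at least as heavy, so all such vertices
  together weigh at most \<open>\<Delta> m\<close>.  The remaining weight is at most \<open>k (m + max w)\<close>, which gives
  \<open>(1 - \<epsilon>) W \<le> (1 + \<epsilon>) m\<close>, and \<open>(1 + \<epsilon>) / (1 - \<epsilon>)\<^sup>2 \<le> 1 + 7 \<epsilon>\<close>.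
\<close>

section \<open>Greedy colorings\<close>

text \<open>The order by weight matters because in an arbitrary order a light vertex could turn away
  neighbours far heavier than its own class. On the algorithmic side \<open>k\<close> is written in
  binary, so trying all \<open>k\<close> colours may take exponential time; only
  \<open>min k (card V)\<close> colours are used. Nothing is lost: unless all weights vanish, the
  bound on the maximum weight forces \<open>k \<le> card V\<close>, and if they vanish, every proper
  colouring is balanced. Rational loads are compared as natural numbers after clearing denominators,
  and \<open>\<epsilon>\<close> never enters the program.

  The program is not written down explicitly. Its existence follows from closure properties of
  polynomial time on encoded data, from single operations up to loops. The danger there is that
  iterating a polynomial step can blow up the data, so every loop rule asks for a bound on all
  intermediate states in terms of the initial one.\<close>

definition free_for :: "'a set set \<Rightarrow> 'a set \<Rightarrow> ('a \<Rightarrow> nat) \<Rightarrow> 'a \<Rightarrow> nat \<Rightarrow> bool" where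
  "free_for E S f u j \<longleftrightarrow> (\<forall>v\<in>S. f v = j \<longrightarrow> {u, v} \<notin> E)"

definition load :: "('a \<Rightarrow> rat) \<Rightarrow> 'a set \<Rightarrow> ('a \<Rightarrow> nat) \<Rightarrow> nat \<Rightarrow> rat" where
  "load w S f j = sum w {v \<in> S. f v = j}"

text \<open>The condition \<open>w u \<le> w v\<close> is the trace that the colouring order leaves
  in a static set: whoever is turned away by \<open>v\<close> came after \<open>v\<close>. It allows
  the weight of the set to be charged to class \<open>j\<close>.\<close>

definition blocked :: "'a set set \<Rightarrow> ('a \<Rightarrow> rat) \<Rightarrow> 'a set \<Rightarrow> ('a \<Rightarrow> nat) \<Rightarrow> nat \<Rightarrow> 'a set" where
  "blocked E w S f j = {u \<in> S. \<exists>v\<in>S. f v = j \<and> {u, v} \<in> E \<and> w u \<le> w v}"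

text \<open>A relation instead of a function leaves ties open, so that an abstract existence proof
  and the concrete program can both be instances. The values of \<open>f\<close> outside the
  coloured set are arbitrary.\<close>

inductive greedy :: "'a set \<Rightarrow> 'a set set \<Rightarrow> ('a \<Rightarrow> rat) \<Rightarrow> nat \<Rightarrow> 'a set \<Rightarrow> ('a \<Rightarrow> nat) \<Rightarrow> bool"
  for V E w K where
  greedy_empty: "greedy V E w K {} f"
| greedy_insert: "greedy V E w K (insert u S) (f(u := j))"
    if "greedy V E w K S f" "u \<in> V - S" "\<And>v. v \<in> V - S \<Longrightarrow> w v \<le> w u"
       "j \<in> {1..K}" "free_for E S f u j"
       "\<And>j'. j' \<in> {1..K} \<Longrightarrow> free_for E S f u j' \<Longrightarrow> load w S f j \<le> load w S f j'"

section \<open>Degrees, neighbours and free colours\<close>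

lemma vertex_degree_le_max_degree:
  assumes "finite V" "v \<in> V"
  shows "vertex_degree E v \<le> max_degree V E"
  unfolding max_degree_def using assms by (intro Max_ge) auto

lemma weight_le_max_weight:
  assumes "finite V" "v \<in> V"
  shows "w v \<le> max_weight V w"
  unfolding max_weight_def using assms by (intro Max_ge) auto

lemma max_weight_nonneg: "finite V \<Longrightarrow> 0 \<le> max_weight V w"
  unfolding max_weight_def by (intro Max_ge) auto

lemma vertex_degree_eq_card_neighbours:
  assumes "weighted_graph V E w"
  shows "vertex_degree E u = card {v \<in> V. {u, v} \<in> E}"
proof -
  have "{e \<in> E. u \<in> e} = (\<lambda>v. {u, v}) ` {v \<in> V. {u, v} \<in> E}"
  proof (intro equalityI subsetI)
    fix e assume e: "e \<in> {e \<in> E. u \<in> e}"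
    then have "card e = 2" "e \<subseteq> V" "u \<in> e"
      using assms unfolding weighted_graph_def by auto
    then obtain v where "e = {u, v}"
      by (auto simp: card_2_iff)
    with e \<open>e \<subseteq> V\<close> show "e \<in> (\<lambda>v. {u, v}) ` {v \<in> V. {u, v} \<in> E}" by auto
  qed auto
  moreover have "inj_on (\<lambda>v. {u, v}) {v \<in> V. {u, v} \<in> E}"
    by (auto simp: inj_on_def doubleton_eq_iff)
  ultimately show ?thesis
    unfolding vertex_degree_def by (simp add: card_image)
qed

lemma card_neighbours_le_max_degree:
  assumes "weighted_graph V E w" "u \<in> V"
  shows "card {v \<in> V. {u, v} \<in> E} \<le> max_degree V E"
  using vertex_degree_le_max_degree[of V u E] vertex_degree_eq_card_neighbours[OF assms(1)] assms
  by (simp add: weighted_graph_def)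

text \<open>This keeps the palette larger than the degree even after it is cut down to
  \<open>card V\<close> colours.\<close>

lemma max_degree_less_card:
  assumes "weighted_graph V E w" "V \<noteq> {}"
  shows "max_degree V E < card V"
proof -
  have fin: "finite V" using assms(1) by (simp add: weighted_graph_def)
  have "vertex_degree E u < card V" if "u \<in> V" for u
  proof -
    have "{u, u} \<notin> E" using assms(1) unfolding weighted_graph_def by fastforce
    then have "u \<notin> {v \<in> V. {u, v} \<in> E}" by simp
    then have "{v \<in> V. {u, v} \<in> E} \<subset> V" using that by blast
    then show ?thesis
      unfolding vertex_degree_eq_card_neighbours[OF assms(1)] by (rule psubset_card_mono[OF fin])
  qed
  moreover have "0 < card V" using fin assms(2) by (simp add: card_gt_0_iff)
  ultimately show ?thesis
    unfolding max_degree_def using fin by (subst Max_less_iff) auto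
qed

text \<open>Every forbidden colour is the image under \<open>f\<close> of some neighbour of
  \<open>u\<close>.\<close>

lemma card_not_free_le:
  assumes "weighted_graph V E w" "u \<in> V" "S \<subseteq> V"
  shows "card {j \<in> {1..K}. \<not> free_for E S f u j} \<le> max_degree V E"
proof -
  have fin: "finite {v \<in> V. {u, v} \<in> E}" using assms(1) by (simp add: weighted_graph_def)
  have "{j \<in> {1..K}. \<not> free_for E S f u j} \<subseteq> f ` {v \<in> V. {u, v} \<in> E}"
    using assms(3) unfolding free_for_def by auto
  then have "card {j \<in> {1..K}. \<not> free_for E S f u j} \<le> card {v \<in> V. {u, v} \<in> E}"
    using fin by (meson card_image_le card_mono finite_imageI le_trans)
  then show ?thesis using card_neighbours_le_max_degree[OF assms(1,2)] by linarith
qed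

lemma card_free_ge:
  assumes "weighted_graph V E w" "u \<in> V" "S \<subseteq> V"
  shows "K \<le> card {j \<in> {1..K}. free_for E S f u j} + max_degree V E"
proof -
  have "{1..K} = {j \<in> {1..K}. free_for E S f u j} \<union> {j \<in> {1..K}. \<not> free_for E S f u j}"
    by blast
  then have "card {1..K} \<le> card {j \<in> {1..K}. free_for E S f u j} + card {j \<in> {1..K}. \<not> free_for E S f u j}"
    by (metis (no_types, lifting) card_Un_le)
  then show ?thesis using card_not_free_le[OF assms, of K f] by simp
qed

lemma free_exists:
  assumes "weighted_graph V E w" "u \<in> V" "S \<subseteq> V" "max_degree V E < K"
  shows "\<exists>j\<in>{1..K}. free_for E S f u j"
proof (rule ccontr)
  assume "\<not> ?thesis"
  then have "{j \<in> {1..K}. free_for E S f u j} = {}" by blast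
  then have "K \<le> max_degree V E"
    using card_free_ge[OF assms(1-3), of K f] by (simp only: card.empty)
  with assms(4) show False by simp
qed

section \<open>Invariants and load bounds of greedy colourings\<close>

lemma greedy_subset: "greedy V E w K S f \<Longrightarrow> S \<subseteq> V"
  by (induction rule: greedy.induct) auto

lemma greedy_colour: "greedy V E w K S f \<Longrightarrow> v \<in> S \<Longrightarrow> f v \<in> {1..K}"
  by (induction rule: greedy.induct) auto

lemma greedy_independent:
  assumes "greedy V E w K S f" "weighted_graph V E w"
  shows "independent_set E {v \<in> S. f v = i}"
  using assms
proof (induction rule: greedy.induct)
  case (greedy_insert S f u j)
  have "{u, u} \<notin> E" using greedy_insert.prems unfolding weighted_graph_def by fastforce
  with greedy_insert show ?case
    by (auto simp: independent_set_def free_for_def insert_commute)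
qed (simp add: independent_set_def)

lemma load_insert:
  assumes "finite S" "u \<notin> S"
  shows "load w (insert u S) (f(u := j)) i = load w S f i + (if i = j then w u else 0)"
proof -
  have "{v \<in> insert u S. (f(u := j)) v = i} = (if i = j then insert u {v \<in> S. f v = i} else {v \<in> S. f v = i})"
    using assms(2) by auto
  then show ?thesis using assms by (simp add: load_def)
qed

lemma sum_load:
  assumes "finite S" "\<And>v. v \<in> S \<Longrightarrow> f v \<in> {1..K}"
  shows "(\<Sum>i\<in>{1..K}. load w S f i) = sum w S"
  unfolding load_def using assms by (intro sum.group) auto

lemma load_nonneg:
  assumes "\<And>v. v \<in> S \<Longrightarrow> 0 \<le> w v"
  shows "0 \<le> load w S f i"
  unfolding load_def using assms by (intro sum_nonneg) auto

text \<open>The removed vertex is the one that joined its class last: at that moment the class was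
  lightest among the at least \<open>K - \<Delta>\<close> free ones.\<close>

lemma greedy_upper:
  assumes "greedy V E w K S f" "weighted_graph V E w" "max_degree V E \<le> K"
    and "{v \<in> S. f v = i} \<noteq> {}"
  shows "\<exists>v \<in> {v \<in> S. f v = i}.
           of_nat (K - max_degree V E) * sum w ({v \<in> S. f v = i} - {v}) \<le> sum w S"
  using assms
proof (induction rule: greedy.induct)
  case (greedy_insert S f u j)
  have SV: "S \<subseteq> V" using greedy_subset greedy_insert.hyps(1) by blast
  then have fin: "finite S" and pos: "\<And>v. v \<in> insert u S \<Longrightarrow> 0 \<le> w v"
    using greedy_insert.prems greedy_insert.hyps(2) finite_subset unfolding weighted_graph_def by blast+
  have uS: "u \<notin> S" using greedy_insert.hyps(2) by blast
  have le: "sum w S \<le> sum w (insert u S)" using fin uS pos by simp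
  show ?case
  proof (cases "i = j")
    case True
    let ?F = "{j \<in> {1..K}. free_for E S f u j}"
    have "{v \<in> insert u S. (f(u := j)) v = i} - {u} = {v \<in> S. f v = j}" using uS True by auto
    moreover have "of_nat (K - max_degree V E) * load w S f j \<le> sum w S"
    proof -
      have "of_nat (K - max_degree V E) * load w S f j \<le> of_nat (card ?F) * load w S f j"
      proof (intro mult_right_mono load_nonneg)
        show "of_nat (K - max_degree V E) \<le> (of_nat (card ?F) :: rat)"
          using card_free_ge[OF greedy_insert.prems(1) _ SV, of u K f] greedy_insert.hyps(2) by simp
      qed (use pos in auto)
      also have "\<dots> = (\<Sum>i\<in>?F. load w S f j)" by simp
      also have "\<dots> \<le> (\<Sum>i\<in>?F. load w S f i)"
        using greedy_insert.hyps by (intro sum_mono) auto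
      also have "\<dots> \<le> (\<Sum>i\<in>{1..K}. load w S f i)"
        using pos by (intro sum_mono2 load_nonneg) auto
      also have "\<dots> = sum w S"
        using fin greedy_colour[OF greedy_insert.hyps(1)] by (rule sum_load)
      finally show ?thesis .
    qed
    ultimately show ?thesis using le True by (intro bexI[of _ u]) (auto simp: load_def)
  next
    case False
    then have eq: "{v \<in> insert u S. (f(u := j)) v = i} = {v \<in> S. f v = i}" using uS by auto
    \<comment> \<open>A class that \<open>u\<close> does not join keeps its old witness, as the
      total on the right only grows.\<close>
    then show ?thesis using greedy_insert.IH greedy_insert.prems le
      by (metis (no_types, lifting) order_trans)
  qed
qed simp

lemma greedy_weights_ordered:
  "greedy V E w K S f \<Longrightarrow> v \<in> S \<Longrightarrow> u \<in> V - S \<Longrightarrow> w u \<le> w v"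
  by (induction rule: greedy.induct) auto

text \<open>A vertex is placed on a class already heavier than \<open>m \<ge> load j\<close> only if colour \<open>j\<close> is
  blocked by a neighbour, which was coloured earlier and hence is at least as heavy.\<close>

lemma greedy_excess:
  assumes "greedy V E w K S f" "weighted_graph V E w" "j \<in> {1..K}" "load w S f j \<le> m"
  shows "(\<Sum>i\<in>{1..K}. max 0 (load w S f i - m - max_weight V w)) \<le> sum w (blocked E w S f j)"
  using assms
proof (induction rule: greedy.induct)
  case (greedy_empty f)
  then show ?case using max_weight_nonneg[of V w]
    by (simp add: load_def blocked_def weighted_graph_def)
next
  case (greedy_insert S f u i)
  let ?M = "max_weight V w" and ?S = "insert u S" and ?f = "f(u := i)"
  have SV: "S \<subseteq> V" using greedy_subset greedy_insert.hyps(1) by blast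
  then have fin: "finite S" and pos: "\<And>v. v \<in> insert u S \<Longrightarrow> 0 \<le> w v" and finV: "finite V"
    using greedy_insert.prems greedy_insert.hyps(2) finite_subset unfolding weighted_graph_def by blast+
  have uS: "u \<notin> S" using greedy_insert.hyps(2) by blast
  have wu: "0 \<le> w u" "w u \<le> ?M"
    using pos weight_le_max_weight[OF finV] greedy_insert.hyps(2) by auto
  \<comment> \<open>The bound \<open>m\<close> is a fixed number rather than the current load of
    \<open>j\<close>, so that the induction hypothesis applies to \<open>S\<close>, where the load
    can only be smaller.\<close>
  have lj: "load w S f j \<le> m"
    using greedy_insert.prems(3) wu(1) unfolding load_insert[OF fin uS] by (simp split: if_splits)
  have IH: "(\<Sum>i\<in>{1..K}. max 0 (load w S f i - m - ?M)) \<le> sum w (blocked E w S f j)"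
    using greedy_insert.IH greedy_insert.prems lj by blast
  have mono: "blocked E w S f j \<subseteq> blocked E w ?S ?f j"
    using uS by (auto simp: blocked_def)
  have finB: "finite (blocked E w ?S ?f j)" using fin by (simp add: blocked_def)
  have posB: "0 \<le> w v" if "v \<in> blocked E w ?S ?f j" for v
    using that pos by (auto simp: blocked_def)
  have le: "sum w (blocked E w S f j) \<le> sum w (blocked E w ?S ?f j)"
    using posB by (intro sum_mono2[OF finB mono]) auto
  show ?case
  proof (cases "load w S f i \<le> m")
    case True
    \<comment> \<open>A class of weight at most \<open>m\<close> grows to at most
      \<open>m + ?M\<close>, so its term stays 0. This is why the excess is measured from
      \<open>m + ?M\<close>.\<close>
    have "(\<Sum>l\<in>{1..K}. max 0 (load w ?S ?f l - m - ?M)) \<le> (\<Sum>l\<in>{1..K}. max 0 (load w S f l - m - ?M))"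
      using True wu by (intro sum_mono) (auto simp: load_insert[OF fin uS])
    with IH le show ?thesis by linarith
  next
    case False
    then have "\<not> free_for E S f u j" using greedy_insert.hyps(6)[of j] greedy_insert.prems lj by auto
    then obtain v where v: "v \<in> S" "f v = j" "{u, v} \<in> E" unfolding free_for_def by blast
    moreover have "w u \<le> w v"
      using greedy_weights_ordered[OF greedy_insert.hyps(1) v(1) greedy_insert.hyps(2)] .
    ultimately have "u \<in> blocked E w ?S ?f j" using uS unfolding blocked_def by auto
    moreover have "u \<notin> blocked E w S f j" using uS by (auto simp: blocked_def)
    \<comment> \<open>Only the term of colour \<open>i\<close> grows, by at most \<open>w u\<close>,
      and \<open>u\<close> pays for it by being new in the blocked set.\<close>
    ultimately have "sum w (insert u (blocked E w S f j)) \<le> sum w (blocked E w ?S ?f j)"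
      using posB mono by (intro sum_mono2[OF finB]) auto
    then have "w u + sum w (blocked E w S f j) \<le> sum w (blocked E w ?S ?f j)"
      using \<open>u \<notin> blocked E w S f j\<close> finite_subset[OF mono finB] by simp
    moreover have "(\<Sum>l\<in>{1..K}. max 0 (load w ?S ?f l - m - ?M))
        \<le> (\<Sum>l\<in>{1..K}. max 0 (load w S f l - m - ?M) + (if l = i then w u else 0))"
      using wu by (intro sum_mono) (auto simp: load_insert[OF fin uS])
    moreover have "\<dots> = (\<Sum>l\<in>{1..K}. max 0 (load w S f l - m - ?M)) + w u"
      using greedy_insert.hyps(4) by (simp add: sum.distrib)
    ultimately show ?thesis using IH by linarith
  qed
qed

text \<open>Charge each blocked vertex to a neighbour in class \<open>j\<close> that is at least as
  heavy. A vertex \<open>v\<close> of the class is charged by at most \<open>max_degree V E\<close>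
  neighbours, each of weight at most \<open>w v\<close>.\<close>

lemma sum_blocked_le:
  assumes G: "weighted_graph V E w"
  shows "sum w (blocked E w V f j) \<le> of_nat (max_degree V E) * load w V f j"
proof -
  let ?C = "{v \<in> V. f v = j}" and ?N = "\<lambda>v. {u \<in> V. {v, u} \<in> E \<and> w u \<le> w v}"
  have fin: "finite V" and pos: "\<And>v. v \<in> V \<Longrightarrow> 0 \<le> w v"
    using G by (auto simp: weighted_graph_def)
  have "blocked E w V f j = (\<Union>v\<in>?C. ?N v)"
    by (auto simp: blocked_def insert_commute)
  moreover have "sum w (\<Union>v\<in>T. ?N v) \<le> (\<Sum>v\<in>T. sum w (?N v))" if "finite T" for T
    using that
  proof (induction T rule: finite_induct)
    case (insert v T)
    have "sum w (?N v \<union> (\<Union>v\<in>T. ?N v)) \<le> sum w (?N v) + sum w (\<Union>v\<in>T. ?N v)"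
      using fin pos insert.hyps by (subst sum_Un) (auto intro: sum_nonneg)
    then show ?case using insert by simp
  qed simp
  ultimately have "sum w (blocked E w V f j) \<le> (\<Sum>v\<in>?C. sum w (?N v))"
    using fin by simp
  also have "\<dots> \<le> (\<Sum>v\<in>?C. of_nat (max_degree V E) * w v)"
  proof (rule sum_mono)
    fix v assume v: "v \<in> ?C"
    have "card (?N v) \<le> card {u \<in> V. {v, u} \<in> E}" using fin by (intro card_mono) auto
    then have "card (?N v) \<le> max_degree V E" using card_neighbours_le_max_degree[OF G, of v] v by simp
    moreover have "sum w (?N v) \<le> of_nat (card (?N v)) * w v" by (rule sum_bounded_above) auto
    moreover have "of_nat (card (?N v)) * w v \<le> of_nat (max_degree V E) * w v"
      using calculation(1) pos v by (intro mult_right_mono) auto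
    ultimately show "sum w (?N v) \<le> of_nat (max_degree V E) * w v" by linarith
  qed
  finally show ?thesis by (simp add: load_def sum_distrib_left)
qed

text \<open>Cut every class at height \<open>?m + ?M\<close>. The lower parts amount to at most
  \<open>K\<close> times this height; the upper parts are the excess of
  \<open>greedy_excess\<close>, with the final load of \<open>j\<close> as the fixed bound.\<close>

lemma greedy_lower:
  assumes "greedy V E w K V f" "weighted_graph V E w" "j \<in> {1..K}"
  shows "sum w V \<le> of_nat K * (load w V f j + max_weight V w) + of_nat (max_degree V E) * load w V f j"
proof -
  let ?m = "load w V f j" and ?M = "max_weight V w"
  have fin: "finite V" using assms(2) by (simp add: weighted_graph_def)
  have "sum w V = (\<Sum>i\<in>{1..K}. load w V f i)"
    using sum_load[OF fin greedy_colour[OF assms(1)]] by simp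
  also have "\<dots> \<le> (\<Sum>i\<in>{1..K}. (?m + ?M) + max 0 (load w V f i - ?m - ?M))"
    by (intro sum_mono) (auto simp: max_def)
  also have "\<dots> = of_nat K * (?m + ?M) + (\<Sum>i\<in>{1..K}. max 0 (load w V f i - ?m - ?M))"
    by (simp add: sum.distrib)
  also have "\<dots> \<le> of_nat K * (?m + ?M) + of_nat (max_degree V E) * ?m"
    using greedy_excess[OF assms order_refl] sum_blocked_le[OF assms(2), of f j] by simp
  finally show ?thesis .
qed

section \<open>From load bounds to the approximation ratio\<close>

lemma balance_ratio:
  fixes \<epsilon> x m W k d M :: real
  assumes "0 < \<epsilon>" "\<epsilon> \<le> 1 / 10" "0 < k" "d \<le> \<epsilon> * k" "0 \<le> x" "0 \<le> m"
    and up: "(k - d) * x \<le> W"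
    and low: "W \<le> k * (m + M) + d * m" "k * M \<le> \<epsilon> * W"
  shows "x \<le> (1 + 7 * \<epsilon>) * m"
proof -
  have "k * ((1 - \<epsilon>) * x) \<le> (k - d) * x"
    using mult_right_mono[OF assms(4,5)] by (simp add: algebra_simps)
  with up have xW: "k * ((1 - \<epsilon>) * x) \<le> W" by linarith
  have "d * m \<le> \<epsilon> * k * m" using assms by (intro mult_right_mono) auto
  with low have "(1 - \<epsilon>) * W \<le> k * ((1 + \<epsilon>) * m)" by (simp add: algebra_simps)
  moreover have "(1 - \<epsilon>) * (k * ((1 - \<epsilon>) * x)) \<le> (1 - \<epsilon>) * W"
    using xW assms(2) by (intro mult_left_mono) auto
  ultimately have "k * ((1 - \<epsilon>)\<^sup>2 * x) \<le> k * ((1 + \<epsilon>) * m)"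
    by (simp add: power2_eq_square algebra_simps)
  then have "(1 - \<epsilon>)\<^sup>2 * x \<le> (1 + \<epsilon>) * m" using assms(3) by simp
  also have "\<dots> \<le> ((1 - \<epsilon>)\<^sup>2 * (1 + 7 * \<epsilon>)) * m"
  proof (rule mult_right_mono[OF _ assms(6)])
    \<comment> \<open>The constant 7 enters only here: for \<open>\<epsilon> \<le> 1 / 10\<close>
      the bracket is positive because \<open>13 * \<epsilon>\<close> is at most 1.3, well below
      4.\<close>
    have "(1 - \<epsilon>)\<^sup>2 * (1 + 7 * \<epsilon>) - (1 + \<epsilon>) = \<epsilon> * (4 - 13 * \<epsilon> + 7 * \<epsilon>\<^sup>2)"
      by (simp add: power2_eq_square algebra_simps)
    moreover have "0 \<le> \<epsilon> * (4 - 13 * \<epsilon> + 7 * \<epsilon>\<^sup>2)"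
      using assms(1,2) by (intro mult_nonneg_nonneg add_nonneg_nonneg) auto
    ultimately show "1 + \<epsilon> \<le> (1 - \<epsilon>)\<^sup>2 * (1 + 7 * \<epsilon>)" by linarith
  qed
  finally have "(1 - \<epsilon>)\<^sup>2 * x \<le> (1 - \<epsilon>)\<^sup>2 * ((1 + 7 * \<epsilon>) * m)" by (simp add: mult.assoc)
  moreover have "0 < (1 - \<epsilon>)\<^sup>2" using assms(2) by simp
  ultimately show ?thesis by simp
qed

text \<open>A literal copy of the hypotheses, so that rewriting with the reversed definition folds
  both halves of the theorem.\<close>

definition eq1_hyps :: "'a set \<Rightarrow> 'a set set \<Rightarrow> ('a \<Rightarrow> rat) \<Rightarrow> real \<Rightarrow> nat \<Rightarrow> bool" where
  "eq1_hyps V E w \<epsilon> k \<longleftrightarrow> weighted_graph V E w \<and> 0 < \<epsilon> \<and> \<epsilon> \<le> 1 / 10 \<and> 0 < k \<and>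
     real k \<ge> (real (max_degree V E) + 1) / \<epsilon> \<and>
     real_of_rat (max_weight V w) \<le> \<epsilon> * (real_of_rat (sum w V) / real k)"

lemma eq1_hyps_degree:
  assumes "eq1_hyps V E w \<epsilon> k"
  shows "real (max_degree V E) + 1 \<le> \<epsilon> * real k" "max_degree V E < k"
proof -
  show *: "real (max_degree V E) + 1 \<le> \<epsilon> * real k"
    using assms unfolding eq1_hyps_def by (auto simp: pos_divide_le_eq mult.commute)
  have "\<epsilon> * real k \<le> 1 * real k"
    using assms unfolding eq1_hyps_def by (intro mult_right_mono) auto
  with * show "max_degree V E < k" by simp
qed

text \<open>Unless all weights vanish, the weight bound forces \<open>k \<le> \<epsilon> card V\<close>.\<close>

lemma eq1_hyps_cases:
  assumes "eq1_hyps V E w \<epsilon> k"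
  shows "(\<forall>v\<in>V. w v = 0) \<or> min k (card V) = k"
proof (cases "sum w V = 0")
  case True
  then show ?thesis
    using assms sum_nonneg_eq_0_iff[of V w] unfolding eq1_hyps_def weighted_graph_def by auto
next
  case False
  have fin: "finite V" and pos: "\<And>v. v \<in> V \<Longrightarrow> 0 \<le> w v"
    using assms by (auto simp: eq1_hyps_def weighted_graph_def)
  have "0 < sum w V" using False sum_nonneg[of V w] pos by force
  then have W: "0 < real_of_rat (sum w V)" by simp
  have "sum w V \<le> of_nat (card V) * max_weight V w"
    by (rule sum_bounded_above) (rule weight_le_max_weight[OF fin])
  then have "real_of_rat (sum w V) \<le> real (card V) * real_of_rat (max_weight V w)"
    by (metis of_rat_less_eq of_rat_mult of_rat_of_nat_eq)
  also have "\<dots> \<le> real (card V) * (\<epsilon> * (real_of_rat (sum w V) / real k))"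
    using assms unfolding eq1_hyps_def by (intro mult_left_mono) auto
  \<comment> \<open>Weakening \<open>\<epsilon>\<close> to 1 is affordable: the palette only asks
    for \<open>k \<le> card V\<close>.\<close>
  also have "\<dots> \<le> real (card V) * (1 * (real_of_rat (sum w V) / real k))"
    using assms W unfolding eq1_hyps_def by (intro mult_left_mono mult_right_mono) auto
  finally have "real_of_rat (sum w V) * real k \<le> real (card V) * real_of_rat (sum w V)"
    using assms unfolding eq1_hyps_def by (simp add: field_simps)
  then have "real k \<le> real (card V)" using W by (simp add: mult.commute)
  then show ?thesis by simp
qed

lemma eq1_hyps_palette:
  assumes "eq1_hyps V E w \<epsilon> k" "V \<noteq> {}"
  shows "max_degree V E < min k (card V)"
  using eq1_hyps_degree(2)[OF assms(1)] max_degree_less_card[OF _ assms(2)] assms(1)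
  by (auto simp: eq1_hyps_def)

text \<open>A palette smaller than \<open>k\<close> leaves some classes empty. By
  \<open>eq1_hyps_cases\<close> this happens only when all weights vanish, and then both sides of
  every EQ1 inequality are 0. Otherwise the palette has all \<open>k\<close> colours and the load
  bounds apply.\<close>

lemma greedy_EQ1:
  assumes H: "eq1_hyps V E w \<epsilon> k" and g: "greedy V E w (min k (card V)) V f"
  shows "k_coloring V E k (\<lambda>i. {v \<in> V. f v = i})" "EQ1 (1 + 7 * \<epsilon>) w k (\<lambda>i. {v \<in> V. f v = i})"
proof -
  have G: "weighted_graph V E w" using H by (simp add: eq1_hyps_def)
  then have pos: "\<And>v. v \<in> V \<Longrightarrow> 0 \<le> w v" and fin: "finite V" by (auto simp: weighted_graph_def)
  show "k_coloring V E k (\<lambda>i. {v \<in> V. f v = i})"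
    unfolding k_coloring_def disjoint_family_on_def
    using greedy_colour[OF g] greedy_independent[OF g G] by fastforce
  show "EQ1 (1 + 7 * \<epsilon>) w k (\<lambda>i. {v \<in> V. f v = i})"
    unfolding EQ1_def
  proof (intro ballI impI)
    fix i j assume ij: "i \<in> {1..k}" "j \<in> {1..k}" and ne: "{v \<in> V. f v = i} \<noteq> {}"
    let ?d = "max_degree V E"
    from eq1_hyps_cases[OF H]
    show "\<exists>v\<in>{v \<in> V. f v = i}. real_of_rat (sum w ({v \<in> V. f v = i} - {v}))
            \<le> (1 + 7 * \<epsilon>) * real_of_rat (sum w {v \<in> V. f v = j})"
    proof
      assume "\<forall>v\<in>V. w v = 0"
      then have "sum w ({v \<in> V. f v = i} - {v}) = 0" "sum w {v \<in> V. f v = j} = 0" for v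
        by (auto intro: sum.neutral)
      then show ?thesis using ne by auto
    next
      assume "min k (card V) = k"
      with g have g: "greedy V E w k V f" by simp
      have dk: "?d \<le> k" using eq1_hyps_degree(2)[OF H] by simp
      obtain v where v: "v \<in> {v \<in> V. f v = i}"
        and up: "of_nat (k - ?d) * sum w ({v \<in> V. f v = i} - {v}) \<le> sum w V"
        using greedy_upper[OF g G dk ne] by blast
      have "real_of_rat (sum w ({v \<in> V. f v = i} - {v})) \<le> (1 + 7 * \<epsilon>) * real_of_rat (load w V f j)"
      proof (rule balance_ratio[where k = "real k" and d = "real ?d" and W = "real_of_rat (sum w V)"
            and M = "real_of_rat (max_weight V w)"])
        show "0 < \<epsilon>" "\<epsilon> \<le> 1 / 10" "0 < real k" using H by (auto simp: eq1_hyps_def)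
        show "real ?d \<le> \<epsilon> * real k" using eq1_hyps_degree(1)[OF H] by simp
        show "0 \<le> real_of_rat (sum w ({v \<in> V. f v = i} - {v}))"
          using pos by (auto intro: sum_nonneg)
        show "0 \<le> real_of_rat (load w V f j)" using load_nonneg[of V w f j] pos by simp
        have "real_of_rat (of_nat (k - ?d) * sum w ({v \<in> V. f v = i} - {v})) \<le> real_of_rat (sum w V)"
          using up by (simp only: of_rat_less_eq)
        then show "(real k - real ?d) * real_of_rat (sum w ({v \<in> V. f v = i} - {v})) \<le> real_of_rat (sum w V)"
          using dk by (simp add: of_rat_mult of_rat_diff of_nat_diff)
        have "real_of_rat (sum w V) \<le> real_of_rat (of_nat k * (load w V f j + max_weight V w) + of_nat ?d * load w V f j)"
          using greedy_lower[OF g G ij(2)] by (simp only: of_rat_less_eq)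
        then show "real_of_rat (sum w V) \<le> real k * (real_of_rat (load w V f j) + real_of_rat (max_weight V w))
             + real ?d * real_of_rat (load w V f j)"
          by (simp add: of_rat_mult of_rat_add)
        show "real k * real_of_rat (max_weight V w) \<le> \<epsilon> * real_of_rat (sum w V)"
          using H by (auto simp: eq1_hyps_def pos_le_divide_eq mult.commute)
      qed
      then show ?thesis using v by (auto simp: load_def)
    qed
  qed
qed

section \<open>Existence of complete greedy colourings\<close>

lemma heaviest_exists:
  assumes "finite S" "S \<noteq> {}"
  obtains u where "u \<in> S" "\<And>v. v \<in> S \<Longrightarrow> w v \<le> (w u :: rat)"
  using arg_min_if_finite[OF assms, of "\<lambda>v. - w v"] by (metis neg_less_iff_less not_le)

lemma least_loaded_free_exists:
  assumes "weighted_graph V E w" "u \<in> V" "S \<subseteq> V" "max_degree V E < K"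
  obtains j where "j \<in> {1..K}" "free_for E S f u j"
    "\<And>j'. j' \<in> {1..K} \<Longrightarrow> free_for E S f u j' \<Longrightarrow> load w S f j \<le> load w S f j'"
proof -
  let ?F = "{j \<in> {1..K}. free_for E S f u j}"
  have "finite ?F" "?F \<noteq> {}" using free_exists[OF assms, of f] by auto
  from arg_min_if_finite[OF this, of "load w S f"] that show ?thesis
    by (metis (no_types, lifting) mem_Collect_eq not_le)
qed

lemma greedy_step_exists:
  assumes "greedy V E w K S f" "weighted_graph V E w" "max_degree V E < K" "S \<noteq> V"
  shows "\<exists>u j. u \<in> V - S \<and> greedy V E w K (insert u S) (f(u := j))"
proof -
  have SV: "S \<subseteq> V" using greedy_subset assms(1) by blast
  have "finite (V - S)" "V - S \<noteq> {}" using assms(2,4) SV by (auto simp: weighted_graph_def)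
  then obtain u where u: "u \<in> V - S" "\<And>v. v \<in> V - S \<Longrightarrow> w v \<le> w u"
    using heaviest_exists[of "V - S" w] by blast
  obtain j where "j \<in> {1..K}" "free_for E S f u j"
    "\<And>j'. j' \<in> {1..K} \<Longrightarrow> free_for E S f u j' \<Longrightarrow> load w S f j \<le> load w S f j'"
    using least_loaded_free_exists[OF assms(2) _ SV assms(3)] u(1) by blast
  then show ?thesis using u assms(1) by (blast intro: greedy_insert)
qed

lemma greedy_complete_exists:
  assumes "weighted_graph V E w" "max_degree V E < K"
  shows "\<exists>f. greedy V E w K V f"
proof -
  have fin: "finite V" using assms by (simp add: weighted_graph_def)
  have "n \<le> card V \<Longrightarrow> \<exists>S f. greedy V E w K S f \<and> card S = n" for n
  proof (induction n)
    case 0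
    show ?case using greedy_empty by fastforce
  next
    case (Suc n)
    then obtain S f where S: "greedy V E w K S f" "card S = n" by auto
    with Suc.prems have "S \<noteq> V" by auto
    with greedy_step_exists[OF S(1) assms] obtain u j
      where "u \<in> V - S" "greedy V E w K (insert u S) (f(u := j))" by blast
    moreover have "finite S" using greedy_subset[OF S(1)] fin finite_subset by blast
    ultimately show ?case using S(2) by (intro exI[of _ "insert u S"]) auto
  qed
  from this[of "card V"] obtain S f where "greedy V E w K S f" "card S = card V" by auto
  with greedy_subset fin card_subset_eq show ?thesis by metis
qed

lemma EQ1_coloring_exists:
  assumes H: "eq1_hyps V E w \<epsilon> k"
  shows "\<exists>C. k_coloring V E k C \<and> EQ1 (1 + 7 * \<epsilon>) w k C"
proof -
  have "\<exists>f. greedy V E w (min k (card V)) V f"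
  \<comment> \<open>For the empty graph the palette \<open>min k 0\<close> has no colour and cannot
    exceed the degree, but there is nothing to colour.\<close>
  proof (cases "V = {}")
    case True
    then show ?thesis using greedy_empty by blast
  next
    case False
    then show ?thesis
      using greedy_complete_exists eq1_hyps_palette[OF H False] H unfolding eq1_hyps_def by blast
  qed
  then show ?thesis using greedy_EQ1[OF H] by blast
qed

section \<open>Polynomial time computability\<close>

text \<open>Coefficients in \<open>nat\<close> make every polynomial monotone, so a polynomial of a
  merely bounded size is still bounded by the composed polynomial; see
  \<open>polybounded_trans\<close>.\<close>

lemma poly_nat_mono:
  fixes q :: "nat poly"
  assumes "x \<le> y"
  shows "poly q x \<le> poly q y"
  by (induction q) (auto intro!: add_mono mult_mono assms)

text \<open>Everything is indexed by instances \<open>c \<in> A\<close>: \<open>E c\<close> is the tree on which the program runs,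
  and the polynomial is uniform in \<open>c\<close>.  Loops extend the environment \<open>E c\<close> by the loop variable and
  the index \<open>c\<close> to a pair, whence the \<open>fst\<close> and \<open>snd\<close> below.\<close>

definition polybounded :: "'c set \<Rightarrow> ('c \<Rightarrow> val) \<Rightarrow> ('c \<Rightarrow> nat) \<Rightarrow> bool" where
  "polybounded A E m \<longleftrightarrow> (\<exists>q :: nat poly. \<forall>c\<in>A. m c \<le> poly q (val_size (E c)))"

lemma polybounded_mono: "polybounded A E m \<Longrightarrow> (\<And>c. c \<in> A \<Longrightarrow> m' c \<le> m c) \<Longrightarrow> polybounded A E m'"
  unfolding polybounded_def by (meson le_trans)

lemma polybounded_subset: "polybounded A E m \<Longrightarrow> B \<subseteq> A \<Longrightarrow> polybounded B E m"
  unfolding polybounded_def by blast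

lemma polybounded_const: "polybounded A E (\<lambda>c. n)"
  unfolding polybounded_def by (rule exI[of _ "[:n:]"]) simp

lemma polybounded_size: "polybounded A E (\<lambda>c. val_size (E c))"
  unfolding polybounded_def by (rule exI[of _ "[:0, 1:]"]) simp

lemma polybounded_add:
  assumes "polybounded A E m" "polybounded A E m'"
  shows "polybounded A E (\<lambda>c. m c + m' c)"
proof -
  obtain q q' where "\<forall>c\<in>A. m c \<le> poly q (val_size (E c))" "\<forall>c\<in>A. m' c \<le> poly q' (val_size (E c))"
    using assms unfolding polybounded_def by blast
  then show ?thesis unfolding polybounded_def
    by (intro exI[of _ "q + q'"]) (auto intro: add_mono)
qed

lemma polybounded_mult:
  assumes "polybounded A E m" "polybounded A E m'"
  shows "polybounded A E (\<lambda>c. m c * m' c)"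
proof -
  obtain q q' where "\<forall>c\<in>A. m c \<le> poly q (val_size (E c))" "\<forall>c\<in>A. m' c \<le> poly q' (val_size (E c))"
    using assms unfolding polybounded_def by blast
  then show ?thesis unfolding polybounded_def
    by (intro exI[of _ "q * q'"]) (auto intro: mult_mono)
qed

lemma polybounded_trans:
  assumes "polybounded A E (\<lambda>c. val_size (F c))" "polybounded A F m"
  shows "polybounded A E m"
proof -
  obtain q q' where q: "\<And>c. c\<in>A \<Longrightarrow> val_size (F c) \<le> poly q (val_size (E c))"
     "\<And>c. c\<in>A \<Longrightarrow> m c \<le> poly q' (val_size (F c))"
    using assms unfolding polybounded_def by blast
  have "m c \<le> poly (pcompose q' q) (val_size (E c))" if "c \<in> A" for c
    using q(2)[OF that] poly_nat_mono[OF q(1)[OF that], of q'] by (simp add: poly_pcompose)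
  then show ?thesis unfolding polybounded_def by blast
qed

lemma polybounded_lift:
  assumes "polybounded A E m" "fst ` B \<subseteq> A"
  shows "polybounded B (\<lambda>p. E (fst p)) (\<lambda>p. m (fst p))"
  using assms unfolding polybounded_def by (meson imageI subsetD)

text \<open>The polynomial for \<open>m\<close> is uniform in the loop index and can be pulled out
  of the sum.\<close>

lemma polybounded_sum:
  assumes "polybounded (Sigma A (\<lambda>c. {..<N c})) (\<lambda>p. E (fst p)) m" "polybounded A E N"
  shows "polybounded A E (\<lambda>c. \<Sum>i<N c. m (c, i))"
proof -
  obtain q q' where q: "\<And>c i. c \<in> A \<Longrightarrow> i < N c \<Longrightarrow> m (c, i) \<le> poly q (val_size (E c))"
     and q': "\<And>c. c \<in> A \<Longrightarrow> N c \<le> poly q' (val_size (E c))"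
    using assms unfolding polybounded_def by fastforce
  have "(\<Sum>i<N c. m (c, i)) \<le> poly (q' * q) (val_size (E c))" if c: "c \<in> A" for c
  proof -
    have "(\<Sum>i<N c. m (c, i)) \<le> (\<Sum>i<N c. poly q (val_size (E c)))"
      by (intro sum_mono q c) simp
    also have "\<dots> \<le> poly (q' * q) (val_size (E c))"
      using q'[OF c] by simp
    finally show ?thesis .
  qed
  then show ?thesis unfolding polybounded_def by blast
qed

text \<open>The result \<open>f\<close> depends on the index and not on the tree, so it can speak of
  graphs, weights and lists directly, without decoding. \<open>T\<close> is the exact running time;
  only its bound has to be polynomial.\<close>

definition polytime :: "'c set \<Rightarrow> ('c \<Rightarrow> val) \<Rightarrow> ('c \<Rightarrow> val) \<Rightarrow> bool" where
  "polytime A E f \<longleftrightarrow> (\<exists>p T. polybounded A E T \<and> (\<forall>c\<in>A. run p (E c) (f c) (T c)))"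

lemma polytimeI: "(\<And>c. c \<in> A \<Longrightarrow> run p (E c) (f c) (T c)) \<Longrightarrow> polybounded A E T \<Longrightarrow> polytime A E f"
  unfolding polytime_def by blast

text \<open>The cost model charges for the output, so a computed value brings its own size bound.
  Composition of programs rests on this.\<close>

lemma polytime_size:
  assumes "polytime A E f"
  shows "polybounded A E (\<lambda>c. val_size (f c))"
  using assms run_time_ge_size unfolding polytime_def by (blast intro: polybounded_mono)

lemma polytime_cong: "polytime A E f \<Longrightarrow> (\<And>c. c \<in> A \<Longrightarrow> f c = g c) \<Longrightarrow> polytime A E g"
  unfolding polytime_def by auto

lemma polytime_lift:
  assumes "polytime A E f" "fst ` B \<subseteq> A"
  shows "polytime B (\<lambda>p. E (fst p)) (\<lambda>p. f (fst p))"
proof -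
  obtain p T where "polybounded A E T" "\<forall>c\<in>A. run p (E c) (f c) (T c)"
    using assms(1) unfolding polytime_def by blast
  then show ?thesis
    using assms(2) by (intro polytimeI[of _ p _ _ "\<lambda>p. T (fst p)"] polybounded_lift) auto
qed

lemma polytime_trans:
  assumes "polytime A E F" "polytime A F g"
  shows "polytime A E g"
proof -
  obtain p T where p: "polybounded A E T" "\<forall>c\<in>A. run p (E c) (F c) (T c)"
    using assms(1) unfolding polytime_def by blast
  obtain p' T' where p': "polybounded A F T'" "\<forall>c\<in>A. run p' (F c) (g c) (T' c)"
    using assms(2) unfolding polytime_def by blast
  show ?thesis
  proof (rule polytimeI)
    show "run (Seq p p') (E c) (g c) (T c + T' c)" if "c \<in> A" for c
      using p p' that by (auto intro: run_Seq)
    show "polybounded A E (\<lambda>c. T c + T' c)"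
      by (rule polybounded_add[OF p(1) polybounded_trans[OF polytime_size[OF assms(1)] p'(1)]])
  qed
qed

lemma polytime_op:
  assumes "\<And>c. c \<in> A \<Longrightarrow> apply_op f (E c) = g c" "polybounded A E (\<lambda>c. val_size (g c))"
  shows "polytime A E g"
proof (rule polytimeI)
  show "run (Op f) (E c) (g c) (val_size (E c) + val_size (g c))" if "c \<in> A" for c
    using run_Op[of f "E c"] assms(1)[OF that] by simp
  show "polybounded A E (\<lambda>c. val_size (E c) + val_size (g c))"
    by (intro polybounded_add polybounded_size assms)
qed

lemma polytime_refl: "polytime A E E"
  by (rule polytime_op[where f = Ident]) (auto intro: polybounded_size)

lemma polytime_const: "polytime A E (\<lambda>c. Num n)"
  by (rule polytime_op[where f = "Const n"]) (auto intro: polybounded_const)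

lemma polytime_Node:
  assumes "polytime A E f" "polytime A E g"
  shows "polytime A E (\<lambda>c. Node (f c) (g c))"
proof -
  obtain p T where p: "polybounded A E T" "\<forall>c\<in>A. run p (E c) (f c) (T c)"
    using assms(1) unfolding polytime_def by blast
  obtain p' T' where p': "polybounded A E T'" "\<forall>c\<in>A. run p' (E c) (g c) (T' c)"
    using assms(2) unfolding polytime_def by blast
  show ?thesis
    using p p'
    by (intro polytimeI[of _ "Fork p p'" _ _ "\<lambda>c. T c + T' c + 1"] run_Fork polybounded_add polybounded_const) auto
qed

text \<open>Applied to \<open>polytime_refl\<close>, the projections read components off the
  environment.\<close>

lemma polytime_First: "polytime A E (\<lambda>c. Node (f c) (g c)) \<Longrightarrow> polytime A E f"
  by (erule polytime_trans, rule polytime_op[where f = First])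
    (auto intro: polybounded_mono[OF polybounded_size])

lemma polytime_Second: "polytime A E (\<lambda>c. Node (f c) (g c)) \<Longrightarrow> polytime A E g"
  by (erule polytime_trans, rule polytime_op[where f = Second])
    (auto intro: polybounded_mono[OF polybounded_size])

text \<open>Environments act like de Bruijn contexts: this rule carries a computation under a new
  binding \<open>X\<close>, and \<open>polytime_top\<close> reads the newest binding.\<close>

lemma polytime_weaken:
  assumes "polytime A E f" "fst ` B \<subseteq> A"
  shows "polytime B (\<lambda>p. Node (E (fst p)) (X p)) (\<lambda>p. f (fst p))"
  by (rule polytime_trans[OF polytime_First[OF polytime_refl] polytime_lift[OF assms]])

lemma polytime_top: "polytime A (\<lambda>p. Node (X p) (Y p)) Y"
  by (rule polytime_Second[OF polytime_refl])

section \<open>Arithmetic and Boolean operations\<close>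

lemma less_two_power_floor_log: "n < 2 ^ Suc (floor_log n)"
  by (cases "n = 0") (auto simp: floor_log_exp2_gt)

lemma floor_log_le_of_le_two_power: "n \<le> 2 ^ b \<Longrightarrow> floor_log n \<le> b"
  using monoD[OF floor_log_mono, of n "2 ^ b"] by simp

lemma floor_log_le: "floor_log n \<le> n"
  by (rule floor_log_le_of_le_two_power) (simp add: less_imp_le)

text \<open>The sum is never larger, as a tree, than the pair of its operands, so the size of the
  pair is the bound. The same holds for differences and products.\<close>

lemma polytime_Add:
  assumes "polytime A E (\<lambda>c. Num (f c))" "polytime A E (\<lambda>c. Num (g c))"
  shows "polytime A E (\<lambda>c. Num (f c + g c))"
proof (rule polytime_trans[OF polytime_Node[OF assms]], rule polytime_op[where f = Add])
  have "floor_log (x + y) \<le> Suc (floor_log x) + Suc (floor_log y)" for x y :: nat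
  proof (rule floor_log_le_of_le_two_power)
    have "x + y \<le> 2 ^ Suc (floor_log x) - 1 + (2 ^ Suc (floor_log y) - 1)"
      using less_two_power_floor_log[of x] less_two_power_floor_log[of y] by linarith
    also have "\<dots> \<le> 2 ^ Suc (floor_log x) * 2 ^ Suc (floor_log y)"
    proof -
      have *: "a - 1 + (b - 1) \<le> a * b" if "a > 0" "b > 0" for a b :: nat
        using that by (cases a; cases b) auto
      show ?thesis by (rule *) simp_all
    qed
    finally show "x + y \<le> 2 ^ (Suc (floor_log x) + Suc (floor_log y))"
      by (simp add: power_add)
  qed
  then show "polybounded A (\<lambda>c. Node (Num (f c)) (Num (g c))) (\<lambda>c. val_size (Num (f c + g c)))"
    by (intro polybounded_mono[OF polybounded_size]) simp
qed simp

lemma polytime_Sub: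
  assumes "polytime A E (\<lambda>c. Num (f c))" "polytime A E (\<lambda>c. Num (g c))"
  shows "polytime A E (\<lambda>c. Num (f c - g c))"
proof (rule polytime_trans[OF polytime_Node[OF assms]], rule polytime_op[where f = Sub])
  show "polybounded A (\<lambda>c. Node (Num (f c)) (Num (g c))) (\<lambda>c. val_size (Num (f c - g c)))"
    by (intro polybounded_mono[OF polybounded_size]) (simp add: le_SucI trans_le_add1 monoD[OF floor_log_mono])
qed simp

lemma polytime_Mult:
  assumes "polytime A E (\<lambda>c. Num (f c))" "polytime A E (\<lambda>c. Num (g c))"
  shows "polytime A E (\<lambda>c. Num (f c * g c))"
proof (rule polytime_trans[OF polytime_Node[OF assms]], rule polytime_op[where f = Mult])
  have "floor_log (x * y) \<le> Suc (floor_log x) + Suc (floor_log y)" for x y :: nat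
    unfolding power_add
    by (rule floor_log_le_of_le_two_power)
      (auto simp only: power_add intro!: mult_mono less_imp_le[OF less_two_power_floor_log])
  then show "polybounded A (\<lambda>c. Node (Num (f c)) (Num (g c))) (\<lambda>c. val_size (Num (f c * g c)))"
    by (intro polybounded_mono[OF polybounded_size]) simp
qed simp

lemma polytime_if:
  assumes "polytime A E (\<lambda>c. Num (of_bool (P c)))" "polytime A E f" "polytime A E g"
  shows "polytime A E (\<lambda>c. if P c then f c else g c)"
proof -
  obtain b S where b: "polybounded A E S" "\<And>c. c\<in>A \<Longrightarrow> run b (E c) (Num (of_bool (P c))) (S c)"
    using assms(1) unfolding polytime_def by blast
  obtain p T where p: "polybounded A E T" "\<And>c. c\<in>A \<Longrightarrow> run p (E c) (f c) (T c)"
    using assms(2) unfolding polytime_def by blast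
  obtain p' T' where p': "polybounded A E T'" "\<And>c. c\<in>A \<Longrightarrow> run p' (E c) (g c) (T' c)"
    using assms(3) unfolding polytime_def by blast
  show ?thesis
  proof (rule polytimeI)
    show "run (Cond b p p') (E c) (if P c then f c else g c) (S c + (if P c then T c else T' c))"
      if c: "c \<in> A" for c
      using b(2)[OF c] p(2)[OF c] p'(2)[OF c]
      by (auto intro: run_Cond_true run_Cond_false)
    show "polybounded A E (\<lambda>c. S c + (if P c then T c else T' c))"
      by (rule polybounded_mono[OF polybounded_add[OF b(1) polybounded_add[OF p(1) p'(1)]]]) simp
  qed
qed

lemma polytime_if_Num:
  assumes "polytime A E (\<lambda>c. Num (of_bool (P c)))" "polytime A E (\<lambda>c. Num (f c))" "polytime A E (\<lambda>c. Num (g c))"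
  shows "polytime A E (\<lambda>c. Num (if P c then f c else g c))"
  by (rule polytime_cong[OF polytime_if[OF assms]]) simp

text \<open>With truth values 0 and 1, negation is subtraction from 1 and conjunction is
  multiplication.\<close>

lemma polytime_not:
  "polytime A E (\<lambda>c. Num (of_bool (P c))) \<Longrightarrow> polytime A E (\<lambda>c. Num (of_bool (\<not> P c)))"
  by (rule polytime_cong[OF polytime_Sub[OF polytime_const[of _ _ 1]]]) auto

lemma polytime_conj:
  assumes "polytime A E (\<lambda>c. Num (of_bool (P c)))" "polytime A E (\<lambda>c. Num (of_bool (Q c)))"
  shows "polytime A E (\<lambda>c. Num (of_bool (P c \<and> Q c)))"
  by (rule polytime_cong[OF polytime_Mult[OF assms]]) auto

lemma polytime_imp:
  assumes "polytime A E (\<lambda>c. Num (of_bool (P c)))" "polytime A E (\<lambda>c. Num (of_bool (Q c)))"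
  shows "polytime A E (\<lambda>c. Num (of_bool (P c \<longrightarrow> Q c)))"
  by (rule polytime_cong[OF polytime_not[OF polytime_conj[OF assms(1) polytime_not[OF assms(2)]]]]) auto

text \<open>Truncated subtraction makes \<open>1 - (f c - g c)\<close> equal to 1 exactly when
  \<open>f c \<le> g c\<close>.\<close>

lemma polytime_le:
  assumes "polytime A E (\<lambda>c. Num (f c))" "polytime A E (\<lambda>c. Num (g c))"
  shows "polytime A E (\<lambda>c. Num (of_bool (f c \<le> g c)))"
  by (rule polytime_cong[OF polytime_Sub[OF polytime_const[of _ _ 1] polytime_Sub[OF assms]]]) auto

lemma polytime_eq:
  assumes "polytime A E (\<lambda>c. Num (f c))" "polytime A E (\<lambda>c. Num (g c))"
  shows "polytime A E (\<lambda>c. Num (of_bool (f c = g c)))"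
  by (rule polytime_cong[OF polytime_conj[OF polytime_le[OF assms] polytime_le[OF assms(2,1)]]]) auto

lemma polytime_min:
  assumes "polytime A E (\<lambda>c. Num (f c))" "polytime A E (\<lambda>c. Num (g c))"
  shows "polytime A E (\<lambda>c. Num (min (f c) (g c)))"
  unfolding min_def by (intro polytime_if_Num polytime_le assms)

section \<open>Loops\<close>

lemma run_While_iterate:
  assumes "\<And>i. i < n \<Longrightarrow> run b (S i) (d i) (s i)" "\<And>i. i < n \<Longrightarrow> d i \<noteq> Num 0"
    and "\<And>i. i < n \<Longrightarrow> run p (S i) (S (Suc i)) (t i)"
    and "run b (S n) (Num 0) (s n)"
  shows "run (While b p) (S 0) (S n) ((\<Sum>i<n. s i + t i) + s n)"
  using assms
proof (induction n arbitrary: S d s t)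
  case 0
  then show ?case by (auto intro: run_While_false)
next
  case (Suc n)
  \<comment> \<open>The first round is peeled off, as in \<open>run_While_true\<close>; the rest of
    the loop is the induction hypothesis for the sequences shifted by one.\<close>
  have "run (While b p) (S (Suc 0)) (S (Suc n)) ((\<Sum>i<n. s (Suc i) + t (Suc i)) + s (Suc n))"
    using Suc.prems
    by (intro Suc.IH[of "\<lambda>i. S (Suc i)" "\<lambda>i. d (Suc i)" "\<lambda>i. s (Suc i)" "\<lambda>i. t (Suc i)"]) auto
  from run_While_true[OF Suc.prems(1)[of 0] Suc.prems(2)[of 0] Suc.prems(3)[of 0] this]
  show ?case by (simp add: sum.lessThan_Suc_shift add_ac del: sum.lessThan_Suc)
qed

text \<open>The premise \<open>sz\<close> is essential: a step that is polynomial in the current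
  state could square its size in every round. Bounding all states by the initial one turns the times
  of single rounds into polynomials in the initial size.\<close>

lemma polytime_while:
  assumes N: "polybounded A (\<lambda>c. S c 0) N"
    and sz: "polybounded (Sigma A (\<lambda>c. {..N c})) (\<lambda>p. S (fst p) 0) (\<lambda>p. val_size (S (fst p) (snd p)))"
    and test: "polytime (Sigma A (\<lambda>c. {..N c})) (\<lambda>p. S (fst p) (snd p)) d"
    and d: "\<And>c i. c \<in> A \<Longrightarrow> i < N c \<Longrightarrow> d (c, i) \<noteq> Num 0"
           "\<And>c. c \<in> A \<Longrightarrow> d (c, N c) = Num 0"
    and step: "polytime (Sigma A (\<lambda>c. {..<N c})) (\<lambda>p. S (fst p) (snd p)) (\<lambda>p. S (fst p) (Suc (snd p)))"
  shows "polytime A (\<lambda>c. S c 0) (\<lambda>c. S c (N c))"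
proof -
  let ?B = "Sigma A (\<lambda>c. {..N c})" and ?B' = "Sigma A (\<lambda>c. {..<N c})"
  have sub: "?B' \<subseteq> ?B" by auto
  obtain b s where b: "polybounded ?B (\<lambda>p. S (fst p) (snd p)) s"
    "\<And>p. p \<in> ?B \<Longrightarrow> run b (S (fst p) (snd p)) (d p) (s p)"
    using test unfolding polytime_def by blast
  obtain q t where q: "polybounded ?B' (\<lambda>p. S (fst p) (snd p)) t"
    "\<And>p. p \<in> ?B' \<Longrightarrow> run q (S (fst p) (snd p)) (S (fst p) (Suc (snd p))) (t p)"
    using step unfolding polytime_def by blast
  have s: "polybounded ?B (\<lambda>p. S (fst p) 0) s"
    by (rule polybounded_trans[OF sz b(1)])
  have t: "polybounded ?B' (\<lambda>p. S (fst p) 0) t"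
    by (rule polybounded_trans[OF polybounded_subset[OF sz sub] q(1)])
  show ?thesis
  proof (rule polytimeI)
    show "run (While b q) (S c 0) (S c (N c)) ((\<Sum>i<N c. s (c, i) + t (c, i)) + s (c, N c))"
      if c: "c \<in> A" for c
    proof (rule run_While_iterate)
      show "run b (S c i) (d (c, i)) (s (c, i))" if "i < N c" for i
        using b(2)[of "(c, i)"] c that by simp
      show "d (c, i) \<noteq> Num 0" if "i < N c" for i
        using d c that by blast
      show "run q (S c i) (S c (Suc i)) (t (c, i))" if "i < N c" for i
        using q(2)[of "(c, i)"] c that by simp
      show "run b (S c (N c)) (Num 0) (s (c, N c))"
        using b(2)[of "(c, N c)"] c d by simp
    qed
    have "polybounded A (\<lambda>c. S c 0) (\<lambda>c. s (c, N c))"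
      using s unfolding polybounded_def by fastforce
    then show "polybounded A (\<lambda>c. S c 0) (\<lambda>c. (\<Sum>i<N c. s (c, i) + t (c, i)) + s (c, N c))"
      by (intro polybounded_add[OF polybounded_sum[OF polybounded_add[OF polybounded_subset[OF s sub] t] N]])
  qed
qed

text \<open>Numbers are binary, so computability of \<open>N c\<close> does not limit the number of
  rounds; hence the separate bound on its value.\<close>

lemma polytime_for:
  assumes N: "polytime A E (\<lambda>c. Num (N c))" "polybounded A E N"
    and init: "polytime A E (\<lambda>c. f c 0)"
    and sz: "polybounded (Sigma A (\<lambda>c. {..N c})) (\<lambda>p. E (fst p)) (\<lambda>p. val_size (f (fst p) (snd p)))"
    and step: "polytime (Sigma A (\<lambda>c. {..<N c})) (\<lambda>p. Node (Node (E (fst p)) (Num (snd p))) (f (fst p) (snd p)))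
                 (\<lambda>p. f (fst p) (Suc (snd p)))"
  shows "polytime A E (\<lambda>c. f c (N c))"
proof -
  \<comment> \<open>The state holds the number of rounds, the environment, the counter and the
    accumulator. The loop test is \<open>N c - i\<close>, which vanishes exactly after the last
    round.\<close>
  define S where "S c i = Node (Num (N c)) (Node (Node (E c) (Num i)) (f c i))" for c i
  let ?B = "Sigma A (\<lambda>c. {..N c})" and ?B' = "Sigma A (\<lambda>c. {..<N c})"
  have fst: "fst ` ?B \<subseteq> A" "fst ` ?B' \<subseteq> A" by auto
  have "polytime A (\<lambda>c. S c 0) (\<lambda>c. S c (N c))"
  proof (rule polytime_while)
    have E: "polytime A (\<lambda>c. S c 0) E"
      unfolding S_def by (rule polytime_First[OF polytime_First[OF polytime_Second[OF polytime_refl]]])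
    show "polybounded A (\<lambda>c. S c 0) N"
      by (rule polybounded_trans[OF polytime_size[OF E] N(2)])
    have "polybounded ?B (\<lambda>p. E (fst p))
        (\<lambda>p. val_size (Num (N (fst p))) + (val_size (E (fst p)) + (1 + N (fst p)) + val_size (f (fst p) (snd p))) + 3)"
      by (intro polybounded_add polybounded_const sz polybounded_lift[OF N(2) fst(1)]
          polybounded_lift[OF polytime_size[OF N(1)] fst(1)] polybounded_size)
    then have "polybounded ?B (\<lambda>p. E (fst p)) (\<lambda>p. val_size (S (fst p) (snd p)))"
      by (rule polybounded_mono)
        (auto simp: S_def intro: order_trans[OF floor_log_le])
    with polybounded_lift[OF polytime_size[OF E] fst(1)]
    show "polybounded ?B (\<lambda>p. S (fst p) 0) (\<lambda>p. val_size (S (fst p) (snd p)))"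
      by (rule polybounded_trans)
    have Sp: "polytime B (\<lambda>p. S (fst p) (snd p)) (\<lambda>p. Num (N (fst p)))"
      "polytime B (\<lambda>p. S (fst p) (snd p)) (\<lambda>p. Num (snd p))"
      "polytime B (\<lambda>p. S (fst p) (snd p)) (\<lambda>p. E (fst p))"
      "polytime B (\<lambda>p. S (fst p) (snd p)) (\<lambda>p. Node (Node (E (fst p)) (Num (snd p))) (f (fst p) (snd p)))" for B
      unfolding S_def
      by (rule polytime_First[OF polytime_refl] polytime_Second[OF polytime_First[OF polytime_Second[OF polytime_refl]]]
          polytime_First[OF polytime_First[OF polytime_Second[OF polytime_refl]]] polytime_Second[OF polytime_refl])+
    show "polytime ?B (\<lambda>p. S (fst p) (snd p)) (\<lambda>p. Num (N (fst p) - snd p))"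
      by (intro polytime_Sub Sp)
    have "polytime ?B' (\<lambda>p. S (fst p) (snd p)) (\<lambda>p. Node (Num (N (fst p)))
        (Node (Node (E (fst p)) (Num (snd p + 1))) (f (fst p) (Suc (snd p)))))"
      by (intro polytime_Node Sp polytime_Add polytime_const polytime_trans[OF Sp(4) step])
    then show "polytime ?B' (\<lambda>p. S (fst p) (snd p)) (\<lambda>p. S (fst p) (Suc (snd p)))"
      by (simp add: S_def)
  qed auto
  then have "polytime A (\<lambda>c. S c 0) (\<lambda>c. f c (N c))"
    unfolding S_def[of _ "N _"] by (rule polytime_Second[OF polytime_Second])
  moreover have "polytime A E (\<lambda>c. S c 0)"
    unfolding S_def by (intro polytime_Node N init polytime_refl polytime_const)
  ultimately show ?thesis by (rule polytime_trans[rotated])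
qed

section \<open>Bounded sums, products, quantifiers and search\<close>

lemma polybounded_floor_log_sum:
  assumes "polybounded (Sigma A (\<lambda>c. {..<N c})) (\<lambda>p. E (fst p)) (\<lambda>p. val_size (Num (f (fst p) (snd p))))"
    and "polybounded A E N"
  shows "polybounded (Sigma A (\<lambda>c. {..N c})) (\<lambda>p. E (fst p)) (\<lambda>p. val_size (Num (\<Sum>i<snd p. f (fst p) i)))"
proof (rule polybounded_mono)
  let ?M = "\<lambda>c. \<Sum>i<N c. val_size (Num (f c i))"
  have M: "polybounded A E ?M"
    using polybounded_sum[OF assms] by simp
  show "polybounded (Sigma A (\<lambda>c. {..N c})) (\<lambda>p. E (fst p)) (\<lambda>p. ?M (fst p) + 1 + 1)"
    by (intro polybounded_lift[OF polybounded_add[OF polybounded_add[OF M polybounded_const] polybounded_const]]) auto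
  show "val_size (Num (\<Sum>i<snd p. f (fst p) i)) \<le> ?M (fst p) + 1 + 1"
    if "p \<in> Sigma A (\<lambda>c. {..N c})" for p
  proof -
    \<comment> \<open>The bit length of a sum is at most the total bit length of its terms plus one.
      The \<open>Suc\<close> keeps both powers of two in the induction step at least 2, so that
      their sum is at most their product.\<close>
    have *: "(\<Sum>i<r. g i) < 2 ^ Suc (\<Sum>i<r. val_size (Num (g i)))" for r and g :: "nat \<Rightarrow> nat"
    proof (induction r)
      case (Suc r)
      have "(\<Sum>i<Suc r. g i) < 2 ^ Suc (\<Sum>i<r. val_size (Num (g i))) + 2 ^ Suc (floor_log (g r))"
        using Suc less_two_power_floor_log[of "g r"] by simp
      also have "\<dots> \<le> 2 ^ Suc (\<Sum>i<r. val_size (Num (g i))) * 2 ^ Suc (floor_log (g r))"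
      proof -
        have **: "a + b \<le> a * b" if ab: "a \<ge> 2" "b \<ge> 2" for a b :: nat
        proof -
          obtain a' b' where "a = 2 + a'" "b = 2 + b'"
            using ab by (metis le_iff_add)
          then show ?thesis by simp
        qed
        show ?thesis by (rule **) simp_all
      qed
      finally show ?case by (simp add: power_add)
    qed simp
    have "(\<Sum>i<snd p. val_size (Num (f (fst p) i))) \<le> ?M (fst p)"
      using that by (intro sum_mono2) auto
    moreover have "floor_log (\<Sum>i<snd p. f (fst p) i) \<le> Suc (\<Sum>i<snd p. val_size (Num (f (fst p) i)))"
      by (intro floor_log_le_of_le_two_power less_imp_le *)
    ultimately show ?thesis by simp
  qed
qed

lemma polybounded_floor_log_prod:
  assumes "polybounded (Sigma A (\<lambda>c. {..<N c})) (\<lambda>p. E (fst p)) (\<lambda>p. val_size (Num (f (fst p) (snd p))))"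
    and "polybounded A E N"
  shows "polybounded (Sigma A (\<lambda>c. {..N c})) (\<lambda>p. E (fst p)) (\<lambda>p. val_size (Num (\<Prod>i<snd p. f (fst p) i)))"
proof (rule polybounded_mono)
  let ?M = "\<lambda>c. \<Sum>i<N c. val_size (Num (f c i))"
  have M: "polybounded A E ?M"
    using polybounded_sum[OF assms] by simp
  show "polybounded (Sigma A (\<lambda>c. {..N c})) (\<lambda>p. E (fst p)) (\<lambda>p. ?M (fst p) + 1)"
    by (intro polybounded_lift[OF polybounded_add[OF M polybounded_const]]) auto
  show "val_size (Num (\<Prod>i<snd p. f (fst p) i)) \<le> ?M (fst p) + 1"
    if "p \<in> Sigma A (\<lambda>c. {..N c})" for p
  proof -
    have *: "(\<Prod>i<r. g i) \<le> 2 ^ (\<Sum>i<r. val_size (Num (g i)))" for r and g :: "nat \<Rightarrow> nat"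
      unfolding power_sum
      by (intro prod_mono) (use less_imp_le[OF less_two_power_floor_log] in auto)
    have "(\<Sum>i<snd p. val_size (Num (f (fst p) i))) \<le> ?M (fst p)"
      using that by (intro sum_mono2) auto
    moreover have "floor_log (\<Prod>i<snd p. f (fst p) i) \<le> (\<Sum>i<snd p. val_size (Num (f (fst p) i)))"
      by (intro floor_log_le_of_le_two_power *)
    ultimately show ?thesis by simp
  qed
qed

text \<open>Turns bounds in the size of a loop body's environment into bounds in the size of
  \<open>E\<close>: an index below \<open>N c\<close> has polynomial size.\<close>

lemma polybounded_Num_index:
  assumes "polybounded A E N"
  shows "polybounded (Sigma A (\<lambda>c. {..<N c})) (\<lambda>p. E (fst p)) (\<lambda>p. val_size (Node (E (fst p)) (Num (snd p))))"
proof (rule polybounded_mono)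
  show "polybounded (Sigma A (\<lambda>c. {..<N c})) (\<lambda>p. E (fst p)) (\<lambda>p. val_size (E (fst p)) + N (fst p) + 2)"
    by (intro polybounded_add polybounded_const polybounded_size polybounded_lift[OF assms]) auto
qed (auto intro: order_trans[OF floor_log_le])

lemma polytime_sum:
  assumes N: "polytime A E (\<lambda>c. Num (N c))" "polybounded A E N"
    and f: "polytime (Sigma A (\<lambda>c. {..<N c})) (\<lambda>p. Node (E (fst p)) (Num (snd p)))
              (\<lambda>p. Num (f (fst p) (snd p)))"
  shows "polytime A E (\<lambda>c. Num (\<Sum>i<N c. f c i))"
proof (rule polytime_for[OF N, where f = "\<lambda>c r. Num (\<Sum>i<r. f c i)"])
  let ?B = "Sigma A (\<lambda>c. {..<N c})"
  show "polytime A E (\<lambda>c. Num (\<Sum>i<0. f c i))"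
    by (simp add: polytime_const)
  show "polybounded (Sigma A (\<lambda>c. {..N c})) (\<lambda>p. E (fst p)) (\<lambda>p. val_size (Num (\<Sum>i<snd p. f (fst p) i)))"
    by (rule polybounded_floor_log_sum[OF polybounded_trans[OF polybounded_Num_index[OF N(2)] polytime_size[OF f]] N(2)])
  show "polytime ?B (\<lambda>p. Node (Node (E (fst p)) (Num (snd p))) (Num (\<Sum>i<snd p. f (fst p) i)))
     (\<lambda>p. Num (\<Sum>i<Suc (snd p). f (fst p) i))"
    unfolding sum.lessThan_Suc
    by (intro polytime_Add polytime_top polytime_trans[OF polytime_First[OF polytime_refl] f])
qed

lemma polytime_prod:
  assumes N: "polytime A E (\<lambda>c. Num (N c))" "polybounded A E N"
    and f: "polytime (Sigma A (\<lambda>c. {..<N c})) (\<lambda>p. Node (E (fst p)) (Num (snd p)))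
              (\<lambda>p. Num (f (fst p) (snd p)))"
  shows "polytime A E (\<lambda>c. Num (\<Prod>i<N c. f c i))"
proof (rule polytime_for[OF N, where f = "\<lambda>c r. Num (\<Prod>i<r. f c i)"])
  let ?B = "Sigma A (\<lambda>c. {..<N c})"
  show "polytime A E (\<lambda>c. Num (\<Prod>i<0. f c i))"
    by (simp add: polytime_const)
  show "polybounded (Sigma A (\<lambda>c. {..N c})) (\<lambda>p. E (fst p)) (\<lambda>p. val_size (Num (\<Prod>i<snd p. f (fst p) i)))"
    by (rule polybounded_floor_log_prod[OF polybounded_trans[OF polybounded_Num_index[OF N(2)] polytime_size[OF f]] N(2)])
  show "polytime ?B (\<lambda>p. Node (Node (E (fst p)) (Num (snd p))) (Num (\<Prod>i<snd p. f (fst p) i)))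
     (\<lambda>p. Num (\<Prod>i<Suc (snd p). f (fst p) i))"
    unfolding prod.lessThan_Suc
    by (intro polytime_Mult polytime_top polytime_trans[OF polytime_First[OF polytime_refl] f])
qed

text \<open>A bounded universal quantifier is a product of truth values.\<close>

lemma polytime_all:
  assumes N: "polytime A E (\<lambda>c. Num (N c))" "polybounded A E N"
    and P: "polytime (Sigma A (\<lambda>c. {..<N c})) (\<lambda>p. Node (E (fst p)) (Num (snd p)))
              (\<lambda>p. Num (of_bool (P (fst p) (snd p))))"
  shows "polytime A E (\<lambda>c. Num (of_bool (\<forall>i<N c. P c i)))"
proof (rule polytime_cong[OF polytime_prod[OF N P]])
  show "Num (\<Prod>i<N c. of_bool (P c i)) = Num (of_bool (\<forall>i<N c. P c i))" for c
    by (auto simp: of_bool_def prod_zero_iff)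
qed

text \<open>The result is one more than the last index satisfying \<open>P\<close>, and 0 if there is none.\<close>

primrec last_sat :: "(nat \<Rightarrow> bool) \<Rightarrow> nat \<Rightarrow> nat" where
  "last_sat P 0 = 0"
| "last_sat P (Suc i) = (if P i then Suc i else last_sat P i)"

lemma last_sat_le: "last_sat P n \<le> n"
  by (induction n) auto

lemma last_sat_witness:
  assumes "i < n" "P i"
  shows "last_sat P n \<noteq> 0 \<and> P (last_sat P n - 1)"
  using assms by (induction n) (auto simp: less_Suc_eq)

lemma polytime_last_sat:
  assumes N: "polytime A E (\<lambda>c. Num (N c))" "polybounded A E N"
    and P: "polytime (Sigma A (\<lambda>c. {..<N c})) (\<lambda>p. Node (E (fst p)) (Num (snd p)))
              (\<lambda>p. Num (of_bool (P (fst p) (snd p))))"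
  shows "polytime A E (\<lambda>c. Num (last_sat (P c) (N c)))"
proof (rule polytime_for[OF N, where f = "\<lambda>c r. Num (last_sat (P c) r)"])
  let ?B = "Sigma A (\<lambda>c. {..<N c})"
  show "polytime A E (\<lambda>c. Num (last_sat (P c) 0))"
    by (simp add: polytime_const)
  show "polybounded (Sigma A (\<lambda>c. {..N c})) (\<lambda>p. E (fst p)) (\<lambda>p. val_size (Num (last_sat (P (fst p)) (snd p))))"
  proof (rule polybounded_mono[OF polybounded_lift[OF polybounded_add[OF N(2) polybounded_const[of _ _ 1]]]])
    show "val_size (Num (last_sat (P (fst p)) (snd p))) \<le> N (fst p) + 1"
      if "p \<in> Sigma A (\<lambda>c. {..N c})" for p
      using that floor_log_le[of "last_sat (P (fst p)) (snd p)"] last_sat_le[of "P (fst p)" "snd p"]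
      by auto
  qed auto
  show "polytime ?B (\<lambda>p. Node (Node (E (fst p)) (Num (snd p))) (Num (last_sat (P (fst p)) (snd p))))
     (\<lambda>p. Num (last_sat (P (fst p)) (Suc (snd p))))"
    unfolding last_sat.simps unfolding Suc_eq_plus1
    by (intro polytime_if_Num polytime_Add polytime_const polytime_top polytime_trans[OF polytime_First[OF polytime_refl] P]
        polytime_trans[OF polytime_First[OF polytime_refl] polytime_top])
qed

section \<open>Encoded lists\<close>

lemma enc_list_drop: "i < length xs \<Longrightarrow> enc_list (drop i xs) = Node (xs ! i) (enc_list (drop (Suc i) xs))"
  by (metis Cons_nth_drop_Suc enc_list.simps(2))

lemma val_size_enc_list_drop: "val_size (enc_list (drop i xs)) \<le> val_size (enc_list xs)"
proof (induction xs arbitrary: i)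
  case (Cons x xs)
  show ?case
  proof (cases i)
    case (Suc j)
    then show ?thesis using Cons[of j] by simp
  qed simp
qed simp

lemma length_le_val_size_enc_list: "length xs \<le> val_size (enc_list xs)"
  by (induction xs) auto

text \<open>The number of rounds is what is being computed, so the loop is a plain
  \<open>While\<close> whose test is the remaining list: \<open>enc_list []\<close> is the false
  value \<open>Num 0\<close>.\<close>

lemma polytime_length:
  assumes "polytime A E (\<lambda>c. enc_list (xs c))"
  shows "polytime A E (\<lambda>c. Num (length (xs c)))"
proof -
  define S where "S c i = Node (enc_list (drop i (xs c))) (Num i)" for c i
  let ?B = "Sigma A (\<lambda>c. {..length (xs c)})" and ?B' = "Sigma A (\<lambda>c. {..<length (xs c)})"
  have len: "polybounded A (\<lambda>c. S c 0) (\<lambda>c. length (xs c))"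
    by (rule polybounded_mono[OF polybounded_size])
      (simp add: S_def trans_le_add1 le_SucI length_le_val_size_enc_list)
  have "polytime A (\<lambda>c. S c 0) (\<lambda>c. S c (length (xs c)))"
  proof (rule polytime_while[where S = S and N = "\<lambda>c. length (xs c)", OF len])
    have "polybounded ?B (\<lambda>p. S (fst p) 0) (\<lambda>p. val_size (S (fst p) 0) + length (xs (fst p)))"
      by (rule polybounded_add[OF polybounded_size polybounded_lift[OF len]]) auto
    then show "polybounded ?B (\<lambda>p. S (fst p) 0) (\<lambda>p. val_size (S (fst p) (snd p)))"
      by (rule polybounded_mono)
        (auto simp: S_def intro!: add_mono val_size_enc_list_drop order_trans[OF floor_log_le])
    show "polytime ?B (\<lambda>p. S (fst p) (snd p)) (\<lambda>p. enc_list (drop (snd p) (xs (fst p))))"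
      unfolding S_def by (rule polytime_First[OF polytime_refl])
    have "polytime ?B' (\<lambda>p. S (fst p) (snd p)) (\<lambda>p. Node (xs (fst p) ! snd p) (enc_list (drop (Suc (snd p)) (xs (fst p)))))"
      unfolding S_def by (rule polytime_cong[OF polytime_First[OF polytime_refl]]) (auto simp: enc_list_drop)
    from polytime_Second[OF this]
    have "polytime ?B' (\<lambda>p. S (fst p) (snd p)) (\<lambda>p. Node (enc_list (drop (Suc (snd p)) (xs (fst p)))) (Num (snd p + 1)))"
      by (intro polytime_Node polytime_Add polytime_const) (simp_all add: S_def polytime_top)
    then show "polytime ?B' (\<lambda>p. S (fst p) (snd p)) (\<lambda>p. S (fst p) (Suc (snd p)))"
      by (simp add: S_def)
  qed (simp_all add: enc_list_drop)
  then have "polytime A (\<lambda>c. S c 0) (\<lambda>c. Num (length (xs c)))"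
    unfolding S_def[of _ "length _"] by (rule polytime_Second)
  moreover have "polytime A E (\<lambda>c. S c 0)"
    using assms by (simp add: S_def polytime_Node polytime_const)
  ultimately show ?thesis by (rule polytime_trans[rotated])
qed

lemma polybounded_length:
  assumes "polytime A E (\<lambda>c. enc_list (xs c))"
  shows "polybounded A E (\<lambda>c. length (xs c))"
  by (rule polybounded_mono[OF polytime_size[OF assms] length_le_val_size_enc_list])

text \<open>Heads are dropped one at a time. The index stays below the length, which bounds the
  number of rounds and keeps every intermediate list a \<open>Node\<close>.\<close>

lemma polytime_nth:
  assumes xs: "polytime A E (\<lambda>c. enc_list (xs c))" and i: "polytime A E (\<lambda>c. Num (i c))"
    and less: "\<And>c. c \<in> A \<Longrightarrow> i c < length (xs c)"
  shows "polytime A E (\<lambda>c. xs c ! i c)"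
proof -
  let ?B = "Sigma A (\<lambda>c. {..<i c})"
  have "polytime A E (\<lambda>c. enc_list (drop (i c) (xs c)))"
  proof (rule polytime_for[OF i])
    show "polybounded A E i"
      by (rule polybounded_mono[OF polybounded_length[OF xs] less_imp_le[OF less]])
    show "polytime A E (\<lambda>c. enc_list (drop 0 (xs c)))"
      using xs by simp
    show "polybounded (Sigma A (\<lambda>c. {..i c})) (\<lambda>p. E (fst p)) (\<lambda>p. val_size (enc_list (drop (snd p) (xs (fst p)))))"
      by (rule polybounded_mono[OF polybounded_lift[OF polytime_size[OF xs]] val_size_enc_list_drop]) auto
    have "polytime ?B (\<lambda>p. Node (Node (E (fst p)) (Num (snd p))) (enc_list (drop (snd p) (xs (fst p)))))
            (\<lambda>p. Node (xs (fst p) ! snd p) (enc_list (drop (Suc (snd p)) (xs (fst p)))))"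
      by (rule polytime_cong[OF polytime_top]) (use less in \<open>force simp: enc_list_drop\<close>)
    then show "polytime ?B (\<lambda>p. Node (Node (E (fst p)) (Num (snd p))) (enc_list (drop (snd p) (xs (fst p)))))
            (\<lambda>p. enc_list (drop (Suc (snd p)) (xs (fst p))))"
      by (rule polytime_Second)
  qed
  then have "polytime A E (\<lambda>c. Node (xs c ! i c) (enc_list (drop (Suc (i c)) (xs c))))"
    by (rule polytime_cong) (simp add: enc_list_drop less)
  then show ?thesis by (rule polytime_First)
qed

text \<open>Lists are built from the end, so step \<open>r\<close> of the loop computes entry \<open>N c - r - 1\<close>.\<close>

lemma polytime_list:
  assumes N: "polytime A E (\<lambda>c. Num (N c))" "polybounded A E N"
    and f: "polytime (Sigma A (\<lambda>c. {..<N c})) (\<lambda>p. Node (E (fst p)) (Num (snd p)))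
              (\<lambda>p. f (fst p) (snd p))"
  shows "polytime A E (\<lambda>c. enc_list (map (f c) [0..<N c]))"
proof -
  let ?B = "Sigma A (\<lambda>c. {..<N c})"
  have sz: "val_size (enc_list xs) = (\<Sum>x\<leftarrow>xs. val_size x + 1) + 1" for xs
    by (induction xs) auto
  have "polytime A E (\<lambda>c. enc_list (map (f c) [N c - N c..<N c]))"
  proof (rule polytime_for[OF N, where f = "\<lambda>c r. enc_list (map (f c) [N c - r..<N c])"])
    show "polytime A E (\<lambda>c. enc_list (map (f c) [N c - 0..<N c]))"
      by (simp add: polytime_const)
    have "polybounded A E (\<lambda>c. (\<Sum>i<N c. val_size (f c i) + 1) + 1)"
      using polybounded_sum[OF polybounded_trans[OF polybounded_Num_index[OF N(2)] polybounded_add[OF polytime_size[OF f] polybounded_const[of _ _ 1]]] N(2)]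
      by (intro polybounded_add polybounded_const) simp
    then have "polybounded (Sigma A (\<lambda>c. {..N c})) (\<lambda>p. E (fst p)) (\<lambda>p. (\<Sum>i<N (fst p). val_size (f (fst p) i) + 1) + 1)"
      by (rule polybounded_lift) auto
    then show "polybounded (Sigma A (\<lambda>c. {..N c})) (\<lambda>p. E (fst p))
       (\<lambda>p. val_size (enc_list (map (f (fst p)) [N (fst p) - snd p..<N (fst p)])))"
    proof (rule polybounded_mono)
      fix p
      have "(\<Sum>i\<leftarrow>[N (fst p) - snd p..<N (fst p)]. val_size (f (fst p) i) + 1)
            = (\<Sum>i\<in>{N (fst p) - snd p..<N (fst p)}. val_size (f (fst p) i) + 1)"
        by (subst sum_list_distinct_conv_sum_set) simp_all
      also have "\<dots> \<le> (\<Sum>i<N (fst p). val_size (f (fst p) i) + 1)"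
        by (rule sum_mono2) auto
      finally show "val_size (enc_list (map (f (fst p)) [N (fst p) - snd p..<N (fst p)]))
          \<le> (\<Sum>i<N (fst p). val_size (f (fst p) i) + 1) + 1"
        by (simp add: sz o_def)
    qed
    let ?E = "\<lambda>p. Node (Node (E (fst p)) (Num (snd p))) (enc_list (map (f (fst p)) [N (fst p) - snd p..<N (fst p)]))"
    \<comment> \<open>The map \<open>?h\<close> mirrors the loop index and sends \<open>?B\<close>
      into itself, so the program for \<open>f\<close> and its time bound remain valid at the
      mirrored index.\<close>
    let ?h = "\<lambda>p. (fst p, N (fst p) - (snd p + 1))"
    have EB: "polytime ?B ?E (\<lambda>p. E (fst p))"
      by (rule polytime_First[OF polytime_First[OF polytime_refl]])
    obtain q T where qT: "polybounded ?B (\<lambda>p. Node (E (fst p)) (Num (snd p))) T"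
      "\<And>p. p \<in> ?B \<Longrightarrow> run q (Node (E (fst p)) (Num (snd p))) (f (fst p) (snd p)) (T p)"
      using f unfolding polytime_def by blast
    have h: "?h p \<in> ?B" if "p \<in> ?B" for p
      using that by auto
    have "polytime ?B (\<lambda>p. Node (E (fst (?h p))) (Num (snd (?h p)))) (\<lambda>p. f (fst (?h p)) (snd (?h p)))"
    proof (rule polytimeI)
      show "run q (Node (E (fst (?h p))) (Num (snd (?h p)))) (f (fst (?h p)) (snd (?h p))) (T (?h p))"
        if "p \<in> ?B" for p
        using qT(2)[OF h[OF that]] .
      show "polybounded ?B (\<lambda>p. Node (E (fst (?h p))) (Num (snd (?h p)))) (\<lambda>p. T (?h p))"
        using qT(1) h unfolding polybounded_def by (metis (lifting))
    qed
    moreover have "polytime ?B ?E (\<lambda>p. Node (E (fst (?h p))) (Num (snd (?h p))))"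
      unfolding fst_conv snd_conv
      by (intro polytime_Node EB polytime_Sub polytime_Add polytime_const polytime_Second[OF polytime_First[OF polytime_refl]]
         polytime_trans[OF EB polytime_lift[OF N(1)]]) auto
    ultimately have fh: "polytime ?B ?E (\<lambda>p. f (fst p) (N (fst p) - (snd p + 1)))"
      unfolding fst_conv snd_conv by (rule polytime_trans[rotated])
    show "polytime ?B ?E (\<lambda>p. enc_list (map (f (fst p)) [N (fst p) - Suc (snd p)..<N (fst p)]))"
    proof (rule polytime_cong[OF polytime_Node[OF fh polytime_top]])
      fix p assume "p \<in> ?B"
      then have "snd p < N (fst p)" by auto
      then show "Node (f (fst p) (N (fst p) - (snd p + 1))) (enc_list (map (f (fst p)) [N (fst p) - snd p..<N (fst p)])) =
         enc_list (map (f (fst p)) [N (fst p) - Suc (snd p)..<N (fst p)])"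
        by (simp add: upt_conv_Cons Suc_diff_Suc)
    qed
  qed
  then show ?thesis by simp
qed

section \<open>The greedy program\<close>

definition denominator_product :: "nat \<Rightarrow> (nat \<Rightarrow> rat) \<Rightarrow> nat" where
  "denominator_product n w = (\<Prod>v<n. nat (snd (quotient_of (w v))))"

text \<open>Multiplying all weights by the product of their denominators keeps every number the
  program handles a natural number of polynomial bit length.\<close>

definition scaled_weight :: "nat \<Rightarrow> (nat \<Rightarrow> rat) \<Rightarrow> nat \<Rightarrow> nat" where
  "scaled_weight n w u =
     (\<Prod>v<n. if v = u then nat (fst (quotient_of (w v))) else nat (snd (quotient_of (w v))))"

lemma denominator_product_pos: "0 < denominator_product n w"
  unfolding denominator_product_def by (intro prod_pos) (simp add: quotient_of_denom_pos')

text \<open>Exchanging the denominator of \<open>u\<close> for its numerator multiplies the product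
  of all denominators by \<open>w u\<close>, without any division, which the machine does not
  offer.\<close>

lemma of_nat_scaled_weight:
  assumes "u < n" "0 \<le> w u"
  shows "of_nat (scaled_weight n w u) = of_nat (denominator_product n w) * w u"
proof -
  obtain a b where ab: "quotient_of (w u) = (a, b)" by fastforce
  have b: "0 < b" using quotient_of_denom_pos[OF ab] .
  have w: "w u = of_int a / of_int b" using quotient_of_div[OF ab] .
  then have a: "0 \<le> a" using assms(2) b by (simp add: zero_le_divide_iff)
  let ?R = "\<Prod>v\<in>{..<n} - {u}. nat (snd (quotient_of (w v)))"
  have "scaled_weight n w u = nat a * ?R"
    unfolding scaled_weight_def using assms(1) ab
    by (subst prod.remove[of _ u]) (auto intro!: prod.cong)
  moreover have "denominator_product n w = nat b * ?R"
    unfolding denominator_product_def using assms(1) ab by (subst prod.remove[of _ u]) auto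
  ultimately show ?thesis using a b by (simp add: w)
qed

text \<open>Here and in \<open>colour_load\<close> all vertices are scanned, coloured or not. For
  nonzero \<open>j\<close> this agrees with \<open>free_for\<close> and with \<open>load\<close>,
  because uncoloured vertices carry 0.\<close>

definition colour_free :: "nat \<Rightarrow> nat set set \<Rightarrow> nat list \<Rightarrow> nat \<Rightarrow> nat \<Rightarrow> bool" where
  "colour_free n E cs u j \<longleftrightarrow> (\<forall>v<n. cs ! v = j \<longrightarrow> {u, v} \<notin> E)"

definition colour_load :: "nat \<Rightarrow> (nat \<Rightarrow> rat) \<Rightarrow> nat list \<Rightarrow> nat \<Rightarrow> nat" where
  "colour_load n w cs j = (\<Sum>v<n. if cs ! v = j then scaled_weight n w v else 0)"

text \<open>In the list \<open>cs\<close> of colours, 0 marks the vertices that are not coloured yet.\<close>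

definition next_vertex :: "nat \<Rightarrow> (nat \<Rightarrow> rat) \<Rightarrow> nat list \<Rightarrow> nat" where
  "next_vertex n w cs =
     last_sat (\<lambda>u. cs ! u = 0 \<and> (\<forall>v<n. cs ! v = 0 \<longrightarrow> scaled_weight n w v \<le> scaled_weight n w u)) n - 1"

text \<open>\<open>k\<close> is given in binary, so the palette has to be cut down to \<open>n\<close> colours.\<close>

definition next_colour :: "nat \<Rightarrow> nat set set \<Rightarrow> (nat \<Rightarrow> rat) \<Rightarrow> nat \<Rightarrow> nat list \<Rightarrow> nat \<Rightarrow> nat" where
  "next_colour n E w k cs u =
     last_sat (\<lambda>j. colour_free n E cs u (j + 1) \<and>
       (\<forall>i<min k n. colour_free n E cs u (i + 1) \<longrightarrow>
          colour_load n w cs (j + 1) \<le> colour_load n w cs (i + 1))) (min k n)"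

definition colour_step :: "nat \<Rightarrow> nat set set \<Rightarrow> (nat \<Rightarrow> rat) \<Rightarrow> nat \<Rightarrow> nat list \<Rightarrow> nat list" where
  "colour_step n E w k cs =
     map (\<lambda>v. if v = next_vertex n w cs then next_colour n E w k cs (next_vertex n w cs) else cs ! v)
       [0..<n]"

primrec greedy_colours :: "nat \<Rightarrow> nat set set \<Rightarrow> (nat \<Rightarrow> rat) \<Rightarrow> nat \<Rightarrow> nat \<Rightarrow> nat list" where
  "greedy_colours n E w k 0 = map (\<lambda>v. 0) [0..<n]"
| "greedy_colours n E w k (Suc t) = colour_step n E w k (greedy_colours n E w k t)"

lemma length_greedy_colours [simp]: "length (greedy_colours n E w k t) = n"
  by (cases t) (simp_all add: colour_step_def)

text \<open>True on every instance, even if no colour is free; it bounds the accumulator of the main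
  loop.\<close>

lemma greedy_colours_le: "c \<in> set (greedy_colours n E w k t) \<Longrightarrow> c \<le> n"
proof (induction t arbitrary: c)
  case (Suc t)
  have "next_colour n E w k cs u \<le> n" for cs u
    unfolding next_colour_def by (rule order_trans[OF last_sat_le min.cobounded2])
  with Suc show ?case by (auto simp: colour_step_def)
qed auto

text \<open>If no vertex qualifies, \<open>last_sat\<close> yields 0 and truncated subtraction stays
  at 0. The result is thus a legal index for every list, as reading a row of the instance
  demands.\<close>

lemma next_vertex_less: "0 < n \<Longrightarrow> next_vertex n w cs < n"
  unfolding next_vertex_def
  by (rule le_less_trans[OF diff_le_mono[OF last_sat_le]]) simp

text \<open>The list program simulates the abstract relation. The value 0 beyond \<open>n\<close>
  makes the next state equal to \<open>f(u := j)\<close> as a function, and the cardinality shows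
  that each round colours a new vertex, so that none is left after \<open>n\<close> rounds.\<close>

lemma greedy_greedy_colours:
  assumes G: "weighted_graph {..<n} E w" and K: "max_degree {..<n} E < min k n" and "t \<le> n"
  defines "cs \<equiv> greedy_colours n E w k"
  shows "greedy {..<n} E w (min k n) {v. v < n \<and> cs t ! v \<noteq> 0} (\<lambda>v. if v < n then cs t ! v else 0)
         \<and> card {v. v < n \<and> cs t ! v \<noteq> 0} = t"
  using \<open>t \<le> n\<close>
proof (induction t)
  case 0
  have "{v. v < n \<and> cs 0 ! v \<noteq> 0} = {}" by (auto simp: cs_def)
  show ?case
    unfolding \<open>{v. v < n \<and> cs 0 ! v \<noteq> 0} = {}\<close> by (simp add: greedy_empty)
next
  case (Suc t)
  define S where "S = {v. v < n \<and> cs t ! v \<noteq> 0}"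
  define f where "f v = (if v < n then cs t ! v else 0)" for v
  \<comment> \<open>Scaling by the common positive factor \<open>D\<close> preserves all comparisons
    of weights and of loads, so the program makes legitimate greedy choices.\<close>
  define D :: rat where "D = of_nat (denominator_product n w)"
  have D: "0 < D" unfolding D_def using denominator_product_pos by simp
  have IH: "greedy {..<n} E w (min k n) S f" "card S = t"
    using Suc by (auto simp: S_def f_def[abs_def])
  have pos: "0 \<le> w v" if "v < n" for v using G that by (simp add: weighted_graph_def)
  have sw: "of_nat (scaled_weight n w v) = D * w v" if "v < n" for v
    unfolding D_def by (rule of_nat_scaled_weight[OF that]) (rule pos[OF that])
  have sw_le: "scaled_weight n w v \<le> scaled_weight n w u \<longleftrightarrow> w v \<le> w u" if "v < n" "u < n" for u v
    using D sw[OF that(1)] sw[OF that(2)] by (metis mult_le_cancel_left_pos of_nat_le_iff)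
  have S: "S \<subseteq> {..<n}" and nS: "{..<n} - S = {v. v < n \<and> cs t ! v = 0}"
    by (auto simp: S_def)
  define u where "u = next_vertex n w (cs t)"
  define j where "j = next_colour n E w k (cs t) u"
  have "{..<n} - S \<noteq> {}"
    using IH(2) Suc.prems S by (metis Diff_eq_empty_iff Suc_n_not_le_n card_lessThan subset_antisym)
  then obtain u' where u': "u' \<in> {..<n} - S" "\<And>v. v \<in> {..<n} - S \<Longrightarrow> w v \<le> w u'"
    using heaviest_exists[of "{..<n} - S" w] by blast
  let ?P = "\<lambda>u. cs t ! u = 0 \<and> (\<forall>v<n. cs t ! v = 0 \<longrightarrow> scaled_weight n w v \<le> scaled_weight n w u)"
  have "?P u'" "u' < n" using u' nS sw_le by auto
  from last_sat_witness[of u' n ?P, OF this(2,1)]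
  have Pu: "?P u" unfolding u_def next_vertex_def by blast
  have un: "u < n" unfolding u_def using Suc.prems by (intro next_vertex_less) simp
  have u: "u \<in> {..<n} - S" "\<And>v. v \<in> {..<n} - S \<Longrightarrow> w v \<le> w u"
    using Pu un sw_le unfolding nS by auto
  have free: "colour_free n E (cs t) u i \<longleftrightarrow> free_for E S f u i" if "i \<noteq> 0" for i
    using that by (auto simp: colour_free_def free_for_def S_def f_def)
  have load: "of_nat (colour_load n w (cs t) i) = D * load w S f i" if "i \<noteq> 0" for i
  proof -
    have "of_nat (colour_load n w (cs t) i) = (\<Sum>v<n. if cs t ! v = i then D * w v else 0)"
      unfolding colour_load_def of_nat_sum by (intro sum.cong) (auto simp: sw)
    also have "\<dots> = (\<Sum>v\<in>{v \<in> {..<n}. cs t ! v = i}. D * w v)"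
      by (rule sum.inter_filter[symmetric]) simp
    also have "{v \<in> {..<n}. cs t ! v = i} = {v \<in> S. f v = i}"
      using that by (auto simp: S_def f_def)
    finally show ?thesis by (simp add: load_def sum_distrib_left)
  qed
  have load_le: "colour_load n w (cs t) i \<le> colour_load n w (cs t) i' \<longleftrightarrow> load w S f i \<le> load w S f i'"
    if "i \<noteq> 0" "i' \<noteq> 0" for i i'
    using D load[OF that(1)] load[OF that(2)] by (metis mult_le_cancel_left_pos of_nat_le_iff)
  obtain j' where j': "j' \<in> {1..min k n}" "free_for E S f u j'"
    "\<And>i. i \<in> {1..min k n} \<Longrightarrow> free_for E S f u i \<Longrightarrow> load w S f j' \<le> load w S f i"
    using least_loaded_free_exists[OF G _ S K] un by blast
  let ?Q = "\<lambda>j. colour_free n E (cs t) u (j + 1) \<and>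
       (\<forall>i<min k n. colour_free n E (cs t) u (i + 1) \<longrightarrow>
          colour_load n w (cs t) (j + 1) \<le> colour_load n w (cs t) (i + 1))"
  \<comment> \<open>Colour \<open>j'\<close> is tested at index \<open>j' - 1\<close>;
    \<open>last_sat\<close> adds the one back, so its value is already a colour.\<close>
  have "?Q (j' - 1)" "j' - 1 < min k n" using j' by (auto simp: free load_le)
  from last_sat_witness[of "j' - 1" "min k n" ?Q, OF this(2,1)]
  have Qj: "j \<noteq> 0" "?Q (j - 1)" unfolding j_def next_colour_def by blast+
  have jK: "j \<in> {1..min k n}"
    using Qj(1) last_sat_le[of ?Q "min k n"] unfolding j_def next_colour_def by simp
  have j: "free_for E S f u j"
    "load w S f j \<le> load w S f i" if "i \<in> {1..min k n}" "free_for E S f u i" for i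
  proof -
    show "free_for E S f u j" using Qj by (simp add: free)
    have "i - 1 < min k n" "i - 1 + 1 = i" using that(1) by auto
    then show "load w S f j \<le> load w S f i"
      using Qj that load_le[of j i] free[of i] by auto
  qed
  have g: "greedy {..<n} E w (min k n) (insert u S) (f(u := j))"
    using IH(1) u jK j j'(1,2) by (intro greedy_insert) blast+
  have cs: "cs (Suc t) ! v = (if v = u then j else cs t ! v)" if "v < n" for v
    using that by (simp add: cs_def colour_step_def u_def j_def)
  have "{v. v < n \<and> cs (Suc t) ! v \<noteq> 0} = insert u S"
    using cs un Qj(1) by (auto simp: S_def)
  moreover have "(\<lambda>v. if v < n then cs (Suc t) ! v else 0) = f(u := j)"
    using cs un by (auto simp: f_def)
  moreover have "card (insert u S) = Suc t"
    using IH(2) u(1) finite_subset[OF S] by simp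
  ultimately show ?case using g by simp
qed

lemma greedy_colours_EQ1:
  assumes H: "eq1_hyps {..<n} E w \<epsilon> k"
  defines "c \<equiv> \<lambda>v. greedy_colours n E w k n ! v"
  shows "k_coloring {..<n} E k (color_class n c)" "EQ1 (1 + 7 * \<epsilon>) w k (color_class n c)"
proof -
  let ?f = "\<lambda>v. if v < n then c v else 0"
  have "greedy {..<n} E w (min k (card {..<n})) {..<n} ?f"
  proof (cases "n = 0")
    case True
    then show ?thesis using greedy_empty by fastforce
  next
    case False
    let ?S = "{v. v < n \<and> c v \<noteq> 0}"
    have "max_degree {..<n} E < min k n"
      using eq1_hyps_palette[OF H] False by auto
    then have g: "greedy {..<n} E w (min k n) ?S ?f" "card ?S = n"
      using greedy_greedy_colours[of n E w k n] H unfolding c_def eq1_hyps_def by blast+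
    then have "?S = {..<n}"
      by (intro card_subset_eq) auto
    with g(1) show ?thesis by simp
  qed
  from greedy_EQ1[OF H this]
  show "k_coloring {..<n} E k (color_class n c)" "EQ1 (1 + 7 * \<epsilon>) w k (color_class n c)"
    by (simp_all add: color_class_def[abs_def] cong: conj_cong)
qed

section \<open>Reading the encoded instance\<close>

lemma polytime_instance_rows:
  assumes "polytime A F (\<lambda>c. enc_instance (n c) (E c) (w c) (k c))"
  shows "polytime A F (\<lambda>c. enc_list (map (\<lambda>u. Node (enc_rat (w c u))
          (enc_list (map (\<lambda>v. Num (if {u, v} \<in> E c then 1 else 0)) [0..<n c]))) [0..<n c]))"
  using assms unfolding enc_instance_def by (rule polytime_Second)

lemma polytime_instance_k:
  assumes "polytime A F (\<lambda>c. enc_instance (n c) (E c) (w c) (k c))"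
  shows "polytime A F (\<lambda>c. Num (k c))"
  using assms unfolding enc_instance_def by (rule polytime_First)

text \<open>The encoding does not store \<open>n\<close>. It is the length of the list of rows,
  which also bounds its value by the input size, as loops over the vertices require.\<close>

lemma polytime_instance_n:
  assumes "polytime A F (\<lambda>c. enc_instance (n c) (E c) (w c) (k c))"
  shows "polytime A F (\<lambda>c. Num (n c))" "polybounded A F n"
  using polytime_length[OF polytime_instance_rows[OF assms]] polybounded_length[OF polytime_instance_rows[OF assms]]
  by simp_all

lemma polytime_instance_row:
  assumes I: "polytime A F (\<lambda>c. enc_instance (n c) (E c) (w c) (k c))"
    and u: "polytime A F (\<lambda>c. Num (u c))" "\<And>c. c \<in> A \<Longrightarrow> u c < n c"
  shows "polytime A F (\<lambda>c. Node (enc_rat (w c (u c)))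
          (enc_list (map (\<lambda>v. Num (if {u c, v} \<in> E c then 1 else 0)) [0..<n c])))"
  by (rule polytime_cong[OF polytime_nth[OF polytime_instance_rows[OF I] u(1)]]) (use u(2) in simp_all)

lemma polytime_instance_weight:
  assumes I: "polytime A F (\<lambda>c. enc_instance (n c) (E c) (w c) (k c))"
    and u: "polytime A F (\<lambda>c. Num (u c))" "\<And>c. c \<in> A \<Longrightarrow> u c < n c"
  shows "polytime A F (\<lambda>c. Num (nat (fst (quotient_of (w c (u c))))))"
    "polytime A F (\<lambda>c. Num (nat (snd (quotient_of (w c (u c))))))"
proof -
  have "polytime A F (\<lambda>c. enc_rat (w c (u c)))"
    by (rule polytime_First[OF polytime_instance_row[OF assms]])
  then show "polytime A F (\<lambda>c. Num (nat (fst (quotient_of (w c (u c))))))"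
    "polytime A F (\<lambda>c. Num (nat (snd (quotient_of (w c (u c))))))"
    unfolding enc_rat_def by (rule polytime_First, rule polytime_Second)
qed

lemma polytime_instance_edge:
  assumes I: "polytime A F (\<lambda>c. enc_instance (n c) (E c) (w c) (k c))"
    and u: "polytime A F (\<lambda>c. Num (u c))" "\<And>c. c \<in> A \<Longrightarrow> u c < n c"
    and v: "polytime A F (\<lambda>c. Num (v c))" "\<And>c. c \<in> A \<Longrightarrow> v c < n c"
  shows "polytime A F (\<lambda>c. Num (of_bool ({u c, v c} \<in> E c)))"
  by (rule polytime_cong[OF polytime_nth[OF polytime_Second[OF polytime_instance_row[OF I u]] v(1)]])
    (use v(2) in simp_all)

section \<open>Polynomial time of the greedy step and of the whole program\<close>

lemma polytime_scaled_weight: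
  assumes I: "polytime A F (\<lambda>c. enc_instance (n c) (E c) (w c) (k c))"
    and u: "polytime A F (\<lambda>c. Num (u c))"
  shows "polytime A F (\<lambda>c. Num (scaled_weight (n c) (w c) (u c)))"
proof -
  let ?B = "Sigma A (\<lambda>c. {..<n c})"
  have B: "fst ` ?B \<subseteq> A" by auto
  show ?thesis
    unfolding scaled_weight_def
    by (rule polytime_prod[OF polytime_instance_n[OF I]],
        intro polytime_if_Num polytime_eq polytime_top polytime_weaken[OF u B] polytime_instance_weight[OF polytime_weaken[OF I B] polytime_top])
      auto
qed

lemma polytime_colour_nth:
  assumes cs: "polytime A F (\<lambda>c. enc_list (map Num (cs c)))" and u: "polytime A F (\<lambda>c. Num (u c))"
    and less: "\<And>c. c \<in> A \<Longrightarrow> u c < length (cs c)"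
  shows "polytime A F (\<lambda>c. Num (cs c ! u c))"
  by (rule polytime_cong[OF polytime_nth[OF cs u]]) (use less in simp_all)

lemma polytime_colour_free:
  assumes I: "polytime A F (\<lambda>c. enc_instance (n c) (E c) (w c) (k c))"
    and cs: "polytime A F (\<lambda>c. enc_list (map Num (cs c)))" "\<And>c. c \<in> A \<Longrightarrow> length (cs c) = n c"
    and u: "polytime A F (\<lambda>c. Num (u c))" "\<And>c. c \<in> A \<Longrightarrow> u c < n c"
    and j: "polytime A F (\<lambda>c. Num (j c))"
  shows "polytime A F (\<lambda>c. Num (of_bool (colour_free (n c) (E c) (cs c) (u c) (j c))))"
proof -
  let ?B = "Sigma A (\<lambda>c. {..<n c})"
  have B: "fst ` ?B \<subseteq> A" by auto
  show ?thesis
    unfolding colour_free_def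
    by (rule polytime_all[OF polytime_instance_n[OF I]],
        intro polytime_imp polytime_not polytime_eq polytime_weaken[OF j B] polytime_colour_nth[OF polytime_weaken[OF cs(1) B] polytime_top]
          polytime_instance_edge[OF polytime_weaken[OF I B] polytime_weaken[OF u(1) B] _ polytime_top])
      (use cs(2) u(2) in auto)
qed

lemma polytime_colour_load:
  assumes I: "polytime A F (\<lambda>c. enc_instance (n c) (E c) (w c) (k c))"
    and cs: "polytime A F (\<lambda>c. enc_list (map Num (cs c)))" "\<And>c. c \<in> A \<Longrightarrow> length (cs c) = n c"
    and j: "polytime A F (\<lambda>c. Num (j c))"
  shows "polytime A F (\<lambda>c. Num (colour_load (n c) (w c) (cs c) (j c)))"
proof -
  let ?B = "Sigma A (\<lambda>c. {..<n c})"
  have B: "fst ` ?B \<subseteq> A" by auto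
  show ?thesis
    unfolding colour_load_def
    by (rule polytime_sum[OF polytime_instance_n[OF I]],
        intro polytime_if_Num polytime_eq polytime_const polytime_weaken[OF j B]
          polytime_colour_nth[OF polytime_weaken[OF cs(1) B] polytime_top] polytime_scaled_weight[OF polytime_weaken[OF I B] polytime_top])
      (use cs(2) in auto)
qed

lemma polytime_next_vertex:
  assumes I: "polytime A F (\<lambda>c. enc_instance (n c) (E c) (w c) (k c))"
    and cs: "polytime A F (\<lambda>c. enc_list (map Num (cs c)))" "\<And>c. c \<in> A \<Longrightarrow> length (cs c) = n c"
  shows "polytime A F (\<lambda>c. Num (next_vertex (n c) (w c) (cs c)))"
proof -
  let ?B = "Sigma A (\<lambda>c. {..<n c})"
  let ?B' = "Sigma ?B (\<lambda>p. {..<n (fst p)})"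
  have B: "fst ` ?B \<subseteq> A" by auto
  have B': "fst ` ?B' \<subseteq> ?B" by auto
  \<comment> \<open>One prime marks facts moved under the search over \<open>u\<close>, two primes
    facts moved further under the quantifier over \<open>v\<close>.\<close>
  note I' = polytime_weaken[OF I B] and cs' = polytime_weaken[OF cs(1) B]
  note I'' = polytime_weaken[OF I' B'] and cs'' = polytime_weaken[OF cs' B']
  show ?thesis
    unfolding next_vertex_def
    apply (rule polytime_Sub[OF _ polytime_const])
    apply (rule polytime_last_sat[OF polytime_instance_n[OF I]])
    apply (rule polytime_conj)
     apply (rule polytime_eq[OF polytime_colour_nth[OF cs' polytime_top] polytime_const])
     apply (use cs(2) in auto)[1]
    apply (rule polytime_all[OF polytime_instance_n[OF I']])
    apply (rule polytime_imp)
     apply (rule polytime_eq[OF polytime_colour_nth[OF cs'' polytime_top] polytime_const])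
     apply (use cs(2) in auto)[1]
    apply (rule polytime_le)
     apply (rule polytime_scaled_weight[OF I'' polytime_top])
    apply (rule polytime_scaled_weight[OF I'' polytime_weaken[OF polytime_top B']])
    done
qed

lemma polytime_next_colour:
  assumes I: "polytime A F (\<lambda>c. enc_instance (n c) (E c) (w c) (k c))"
    and cs: "polytime A F (\<lambda>c. enc_list (map Num (cs c)))" "\<And>c. c \<in> A \<Longrightarrow> length (cs c) = n c"
    and u: "polytime A F (\<lambda>c. Num (u c))" "\<And>c. c \<in> A \<Longrightarrow> u c < n c"
  shows "polytime A F (\<lambda>c. Num (next_colour (n c) (E c) (w c) (k c) (cs c) (u c)))"
proof -
  let ?K = "\<lambda>c. min (k c) (n c)"
  let ?B = "Sigma A (\<lambda>c. {..<?K c})"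
  let ?B' = "Sigma ?B (\<lambda>p. {..<?K (fst p)})"
  have B: "fst ` ?B \<subseteq> A" by auto
  have B': "fst ` ?B' \<subseteq> ?B" by auto
  \<comment> \<open>The number \<open>k\<close> may be exponential in the input size; the cut at
    \<open>n\<close> bounds the number of rounds of the loops over colours.\<close>
  have K: "polytime A F (\<lambda>c. Num (?K c))" "polybounded A F ?K"
    by (rule polytime_min[OF polytime_instance_k[OF I] polytime_instance_n(1)[OF I]])
      (rule polybounded_mono[OF polytime_instance_n(2)[OF I]], simp)
  note I' = polytime_weaken[OF I B] and cs' = polytime_weaken[OF cs(1) B] and u' = polytime_weaken[OF u(1) B]
  note I'' = polytime_weaken[OF I' B'] and cs'' = polytime_weaken[OF cs' B'] and u'' = polytime_weaken[OF u' B']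
  have K': "polytime ?B (\<lambda>p. Node (F (fst p)) (Num (snd p))) (\<lambda>p. Num (?K (fst p)))"
      "polybounded ?B (\<lambda>p. Node (F (fst p)) (Num (snd p))) (\<lambda>p. ?K (fst p))"
    by (rule polytime_min[OF polytime_instance_k[OF I'] polytime_instance_n(1)[OF I']])
      (rule polybounded_mono[OF polytime_instance_n(2)[OF I']], simp)
  show ?thesis
    unfolding next_colour_def
    apply (rule polytime_last_sat[OF K])
    apply (rule polytime_conj)
     apply (rule polytime_colour_free[OF I' cs' _ u' _ polytime_Add[OF polytime_top polytime_const]]; use cs(2) u(2) in auto)
    apply (rule polytime_all[OF K'])
    apply (rule polytime_imp)
     apply (rule polytime_colour_free[OF I'' cs'' _ u'' _ polytime_Add[OF polytime_top polytime_const]]; use cs(2) u(2) in auto)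
    apply (rule polytime_le)
     apply (rule polytime_colour_load[OF I'' cs'' _ polytime_Add[OF polytime_weaken[OF polytime_top B'] polytime_const]]; use cs(2) in auto)
    apply (rule polytime_colour_load[OF I'' cs'' _ polytime_Add[OF polytime_top polytime_const]]; use cs(2) in auto)
    done
qed

text \<open>The premise \<open>pos\<close> makes \<open>next_vertex\<close> a legal index. In the
  main loop it comes for free, since a round \<open>t\<close> takes place only for
  \<open>t < n c\<close>.\<close>

lemma polytime_colour_step:
  assumes I: "polytime A F (\<lambda>c. enc_instance (n c) (E c) (w c) (k c))"
    and cs: "polytime A F (\<lambda>c. enc_list (map Num (cs c)))" "\<And>c. c \<in> A \<Longrightarrow> length (cs c) = n c"
    and pos: "\<And>c. c \<in> A \<Longrightarrow> 0 < n c"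
  shows "polytime A F (\<lambda>c. enc_list (map Num (colour_step (n c) (E c) (w c) (k c) (cs c))))"
proof -
  let ?B = "Sigma A (\<lambda>c. {..<n c})"
  have B: "fst ` ?B \<subseteq> A" by auto
  have v: "polytime A F (\<lambda>c. Num (next_vertex (n c) (w c) (cs c)))"
    by (rule polytime_next_vertex[OF I cs])
  have j: "polytime A F (\<lambda>c. Num (next_colour (n c) (E c) (w c) (k c) (cs c) (next_vertex (n c) (w c) (cs c))))"
    by (rule polytime_next_colour[OF I cs v next_vertex_less[OF pos]])
  show ?thesis
    unfolding colour_step_def map_map o_def
    by (rule polytime_list[OF polytime_instance_n[OF I]],
        intro polytime_if_Num polytime_eq polytime_top polytime_weaken[OF v B] polytime_weaken[OF j B]
          polytime_colour_nth[OF polytime_weaken[OF cs(1) B] polytime_top])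
      (use cs(2) in auto)
qed

lemma polytime_greedy_colours:
  assumes I: "polytime A F (\<lambda>c. enc_instance (n c) (E c) (w c) (k c))"
  shows "polytime A F (\<lambda>c. enc_list (map Num (greedy_colours (n c) (E c) (w c) (k c) (n c))))"
proof (rule polytime_for[OF polytime_instance_n[OF I],
      where f = "\<lambda>c t. enc_list (map Num (greedy_colours (n c) (E c) (w c) (k c) t))"])
  let ?B = "Sigma A (\<lambda>c. {..<n c})"
  have B: "fst ` ?B \<subseteq> A" by auto
  show "polytime A F (\<lambda>c. enc_list (map Num (greedy_colours (n c) (E c) (w c) (k c) 0)))"
    unfolding greedy_colours.simps map_map o_def
    by (intro polytime_list polytime_const polytime_instance_n[OF I])
  \<comment> \<open>Since \<open>n\<close> colours of value at most \<open>n\<close> are stored, the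
    crude estimate \<open>floor_log a \<le> a\<close> already gives a quadratic bound.\<close>
  have sz: "val_size (enc_list (map Num cs)) \<le> length cs * (N + 2) + 1" if "\<And>c. c \<in> set cs \<Longrightarrow> c \<le> N" for cs N
    using that
  proof (induction cs)
    case (Cons a cs)
    have "floor_log a \<le> N" using floor_log_le[of a] Cons.prems[of a] by simp
    moreover have "val_size (enc_list (map Num cs)) \<le> length cs * (N + 2) + 1"
      using Cons by simp
    ultimately show ?case by simp
  qed simp
  show "polybounded (Sigma A (\<lambda>c. {..n c})) (\<lambda>p. F (fst p))
     (\<lambda>p. val_size (enc_list (map Num (greedy_colours (n (fst p)) (E (fst p)) (w (fst p)) (k (fst p)) (snd p)))))"
  proof (rule polybounded_mono)
    have "polybounded A F (\<lambda>c. n c * (n c + 2) + 1)"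
      by (intro polybounded_add polybounded_mult polybounded_const polytime_instance_n[OF I])
    then show "polybounded (Sigma A (\<lambda>c. {..n c})) (\<lambda>p. F (fst p)) (\<lambda>p. n (fst p) * (n (fst p) + 2) + 1)"
      by (rule polybounded_lift) auto
    fix p
    show "val_size (enc_list (map Num (greedy_colours (n (fst p)) (E (fst p)) (w (fst p)) (k (fst p)) (snd p))))
        \<le> n (fst p) * (n (fst p) + 2) + 1"
      using sz[of "greedy_colours (n (fst p)) (E (fst p)) (w (fst p)) (k (fst p)) (snd p)" "n (fst p)"]
        greedy_colours_le by simp
  qed
  show "polytime ?B (\<lambda>p. Node (Node (F (fst p)) (Num (snd p)))
           (enc_list (map Num (greedy_colours (n (fst p)) (E (fst p)) (w (fst p)) (k (fst p)) (snd p)))))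
         (\<lambda>p. enc_list (map Num (greedy_colours (n (fst p)) (E (fst p)) (w (fst p)) (k (fst p)) (Suc (snd p)))))"
    unfolding greedy_colours.simps
  proof (rule polytime_colour_step)
    show "polytime ?B (\<lambda>p. Node (Node (F (fst p)) (Num (snd p)))
           (enc_list (map Num (greedy_colours (n (fst p)) (E (fst p)) (w (fst p)) (k (fst p)) (snd p)))))
         (\<lambda>p. enc_instance (n (fst p)) (E (fst p)) (w (fst p)) (k (fst p)))"
      by (rule polytime_trans[OF polytime_First[OF polytime_refl] polytime_weaken[OF I B]])
  qed (auto intro: polytime_top)
qed

theorem theorem7:
  shows "(\<forall>(V :: 'a set) E w (\<epsilon> :: real) (k :: nat).
            weighted_graph V E w \<and> 0 < \<epsilon> \<and> \<epsilon> \<le> 1 / 10 \<and> 0 < k \<and>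
            real k \<ge> (real (max_degree V E) + 1) / \<epsilon> \<and>
            real_of_rat (max_weight V w) \<le> \<epsilon> * (real_of_rat (sum w V) / real k) \<longrightarrow>
            (\<exists>C. k_coloring V E k C \<and> EQ1 (1 + 7 * \<epsilon>) w k C))
       \<and>
         (\<exists>(p :: prog) (q :: nat poly). \<forall>(n :: nat) E w (\<epsilon> :: real) (k :: nat).
            weighted_graph {..<n} E w \<and> 0 < \<epsilon> \<and> \<epsilon> \<le> 1 / 10 \<and> 0 < k \<and>
            real k \<ge> (real (max_degree {..<n} E) + 1) / \<epsilon> \<and>
            real_of_rat (max_weight {..<n} w) \<le> \<epsilon> * (real_of_rat (sum w {..<n}) / real k) \<longrightarrow>
            (\<exists>c t. run p (enc_instance n E w k) (enc_colors n c) t \<and>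
                   t \<le> poly q (val_size (enc_instance n E w k)) \<and>
                   k_coloring {..<n} E k (color_class n c) \<and>
                   EQ1 (1 + 7 * \<epsilon>) w k (color_class n c)))"
  unfolding eq1_hyps_def[symmetric]
proof (intro conjI allI impI)
  fix V :: "'a set" and E w \<epsilon> k
  assume "eq1_hyps V E w \<epsilon> k"
  then show "\<exists>C. k_coloring V E k C \<and> EQ1 (1 + 7 * \<epsilon>) w k C"
    by (rule EQ1_coloring_exists)
next
  let ?I = "\<lambda>(n, E, w, k). enc_instance n E w k"
  let ?O = "\<lambda>(n, E, w, k). enc_list (map Num (greedy_colours n E w k n))"
  \<comment> \<open>The index set is \<open>UNIV\<close>: the program halts in polynomial time on
    every instance, and the hypotheses enter only when its output is shown to be a balanced
    colouring.\<close>
  have "polytime UNIV ?I ?O"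
    using polytime_greedy_colours[of UNIV ?I fst "\<lambda>c. fst (snd c)" "\<lambda>c. fst (snd (snd c))" "\<lambda>c. snd (snd (snd c))"]
      polytime_refl[of UNIV ?I]
    by (simp add: case_prod_beta')
  then obtain p T q where run: "\<And>c. run p (?I c) (?O c) (T c)"
    and T: "\<And>c. T c \<le> poly q (val_size (?I c))"
    unfolding polytime_def polybounded_def by blast
  show "\<exists>p q. \<forall>n E w \<epsilon> k. eq1_hyps {..<n} E w \<epsilon> k \<longrightarrow>
       (\<exists>c t. run p (enc_instance n E w k) (enc_colors n c) t \<and>
              t \<le> poly q (val_size (enc_instance n E w k)) \<and>
              k_coloring {..<n} E k (color_class n c) \<and> EQ1 (1 + 7 * \<epsilon>) w k (color_class n c))"
  proof (rule exI[of _ p], rule exI[of _ q], intro allI impI)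
    fix n :: nat and E w \<epsilon> k
    assume H: "eq1_hyps {..<n} E w \<epsilon> k"
    let ?c = "\<lambda>v. greedy_colours n E w k n ! v"
    have "enc_colors n ?c = ?O (n, E, w, k)"
      unfolding enc_colors_def by (auto intro!: arg_cong[where f = enc_list] nth_equalityI)
    then have "run p (enc_instance n E w k) (enc_colors n ?c) (T (n, E, w, k))"
      using run[of "(n, E, w, k)"] by simp
    moreover have "T (n, E, w, k) \<le> poly q (val_size (enc_instance n E w k))"
      using T[of "(n, E, w, k)"] by simp
    ultimately show "\<exists>c t. run p (enc_instance n E w k) (enc_colors n c) t \<and>
              t \<le> poly q (val_size (enc_instance n E w k)) \<and>
              k_coloring {..<n} E k (color_class n c) \<and> EQ1 (1 + 7 * \<epsilon>) w k (color_class n c)"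
      using greedy_colours_EQ1[OF H] by blast
  qed
qed

end
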